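(* Let $n\ge1$. The functors $\tau_!:\mathrm{Mod}_{\mathcal U}\to\mathrm{Mod}_{\mathcal D}$ and $\tau^*:\mathrm{Mod}_{\mathcal D}\to\mathrm{Mod}_{\mathcal U}$ give an equivalence of categories $\mathrm{Mod}_{\mathcal U}\cong\mathrm{Mod}_{\mathcal D}$. In particular, the category $\mathrm{Mod}_{\mathcal U}$ is self-dual, i.e. equivalent to its opposite category.
   Context: $\mathrm{Vec}$ is the category of finite dimensional complex vector spaces. An $[n]$-weighted finite set is a finite set $S=S_1\sqcup\cdots\sqcup S_n$, written $S=(S_1,\dots,S_n)$, where the elements of $S_i$ have weight $i$. $\mathcal U$ (resp. $\mathcal D$) is the category of $[n]$-weighted finite sets whose morphisms $S\to T$ are bijections that do not decrease (resp. do not increase) weights. A $\mathcal U$-module (resp. $\mathcal D$-module) is a functor $\mathcal U\to\mathrm{Vec}$ (resp. $\mathcal D\to\mathrm{Vec}$) that is nonzero on only finitely many objects up to isomorphism; $\mathrm{Mod}_{\mathcal U}$ and $\mathrm{Mod}_{\mathcal D}$ are the abelian categories of such modules, with natural transformations as morphisms. Changing weights from $i$ to $n-i+1$ gives an equivalence $\tau:\mathcal U\cong\mathcal D$, $(S_1,\dots,S_n)\mapsto(S_n,\dots,S_1)$, which is the identity on underlying bijections. For a $\mathcal U$-module $M$, the $\mathcal D$-module $\tau_!M$ is $\tau_!M(S_1,\dots,S_n)=M(S_n,\dots,S_1)$, a morphism $\varphi:S\to T$ in $\mathcal D$ acting by $M(\varphi):M(S_n,\dots,S_1)\to M(T_n,\dots,T_1)$.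 The pullback $\tau^*$ is defined similarly. *)

theory Defs
  imports "Jordan_Normal_Form.VS_Connect" "HOL-Library.FuncSet"
begin

section \<open>Categories, functors and equivalences\<close>

record ('o, 'm) cat =
  Obj :: "'o set"
  Arr :: "'m set"
  Dom :: "'m \<Rightarrow> 'o"
  Cod :: "'m \<Rightarrow> 'o"
  Id :: "'o \<Rightarrow> 'm"
  Comp :: "'m \<Rightarrow> 'm \<Rightarrow> 'm"

text \<open>\<open>Comp C g f\<close> is \<open>g\<close> after \<open>f\<close>; it is only meaningful if the codomain of \<open>f\<close> is the
  domain of \<open>g\<close>.\<close>

definition Hom :: "('o, 'm) cat \<Rightarrow> 'o \<Rightarrow> 'o \<Rightarrow> 'm set" where
  "Hom C X Y = {f \<in> Arr C. Dom C f = X \<and> Cod C f = Y}"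

locale category =
  fixes C :: "('o, 'm) cat"
  assumes Dom_in_Obj: "f \<in> Arr C \<Longrightarrow> Dom C f \<in> Obj C"
    and Cod_in_Obj: "f \<in> Arr C \<Longrightarrow> Cod C f \<in> Obj C"
    and Id_in_Hom: "X \<in> Obj C \<Longrightarrow> Id C X \<in> Hom C X X"
    and Comp_in_Hom: "f \<in> Hom C X Y \<Longrightarrow> g \<in> Hom C Y Z \<Longrightarrow> Comp C g f \<in> Hom C X Z"
    and Comp_Id_right: "f \<in> Hom C X Y \<Longrightarrow> Comp C f (Id C X) = f"
    and Comp_Id_left: "f \<in> Hom C X Y \<Longrightarrow> Comp C (Id C Y) f = f"
    and Comp_assoc: "f \<in> Hom C W X \<Longrightarrow> g \<in> Hom C X Y \<Longrightarrow> h \<in> Hom C Y Z \<Longrightarrow>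
      Comp C h (Comp C g f) = Comp C (Comp C h g) f"

definition is_iso :: "('o, 'm) cat \<Rightarrow> 'm \<Rightarrow> bool" where
  "is_iso C f \<longleftrightarrow> f \<in> Arr C \<and>
    (\<exists>g \<in> Hom C (Cod C f) (Dom C f).
      Comp C g f = Id C (Dom C f) \<and> Comp C f g = Id C (Cod C f))"

definition isomorphic :: "('o, 'm) cat \<Rightarrow> 'o \<Rightarrow> 'o \<Rightarrow> bool" where
  "isomorphic C X Y \<longleftrightarrow> (\<exists>f \<in> Hom C X Y. is_iso C f)"

definition opposite :: "('o, 'm) cat \<Rightarrow> ('o, 'm) cat" where
  "opposite C = \<lparr>Obj = Obj C, Arr = Arr C, Dom = Cod C, Cod = Dom C, Id = Id C,
    Comp = (\<lambda>g f. Comp C f g)\<rparr>"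

definition full_subcategory :: "('o, 'm) cat \<Rightarrow> ('o \<Rightarrow> bool) \<Rightarrow> ('o, 'm) cat" where
  "full_subcategory C P =
    C\<lparr>Obj := {X \<in> Obj C. P X}, Arr := {f \<in> Arr C. P (Dom C f) \<and> P (Cod C f)}\<rparr>"

record ('o, 'm, 'p, 'q) cat_functor =
  on_obj :: "'o \<Rightarrow> 'p"
  on_arr :: "'m \<Rightarrow> 'q"

locale is_functor = C: category C + D: category D
  for C :: "('o, 'm) cat" and D :: "('p, 'q) cat" +
  fixes F :: "('o, 'm, 'p, 'q) cat_functor"
  assumes on_obj_in_Obj: "X \<in> Obj C \<Longrightarrow> on_obj F X \<in> Obj D"
    and on_arr_in_Hom: "f \<in> Hom C X Y \<Longrightarrow> on_arr F f \<in> Hom D (on_obj F X) (on_obj F Y)"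
    and on_arr_Id: "X \<in> Obj C \<Longrightarrow> on_arr F (Id C X) = Id D (on_obj F X)"
    and on_arr_Comp: "f \<in> Hom C X Y \<Longrightarrow> g \<in> Hom C Y Z \<Longrightarrow>
      on_arr F (Comp C g f) = Comp D (on_arr F g) (on_arr F f)"

definition id_functor :: "('o, 'm, 'o, 'm) cat_functor" where
  "id_functor = \<lparr>on_obj = (\<lambda>X. X), on_arr = (\<lambda>f. f)\<rparr>"

definition comp_functor ::
  "('p, 'q, 'r, 's) cat_functor \<Rightarrow> ('o, 'm, 'p, 'q) cat_functor \<Rightarrow> ('o, 'm, 'r, 's) cat_functor"
where
  "comp_functor G F = \<lparr>on_obj = on_obj G \<circ> on_obj F, on_arr = on_arr G \<circ> on_arr F\<rparr>"

locale natural_transformation = F: is_functor C D F + G: is_functor C D G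
  for C :: "('o, 'm) cat" and D :: "('p, 'q) cat"
    and F G :: "('o, 'm, 'p, 'q) cat_functor" +
  fixes \<eta> :: "'o \<Rightarrow> 'q"
  assumes component_in_Hom: "X \<in> Obj C \<Longrightarrow> \<eta> X \<in> Hom D (on_obj F X) (on_obj G X)"
    and naturality: "f \<in> Hom C X Y \<Longrightarrow>
      Comp D (\<eta> Y) (on_arr F f) = Comp D (on_arr G f) (\<eta> X)"

definition naturally_isomorphic ::
  "('o, 'm) cat \<Rightarrow> ('p, 'q) cat \<Rightarrow>
    ('o, 'm, 'p, 'q) cat_functor \<Rightarrow> ('o, 'm, 'p, 'q) cat_functor \<Rightarrow> bool"
where
  "naturally_isomorphic C D F G \<longleftrightarrow>
    (\<exists>\<eta>. natural_transformation C D F G \<eta> \<and> (\<forall>X \<in> Obj C. is_iso D (\<eta> X)))"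

definition equivalence_of_categories ::
  "('o, 'm) cat \<Rightarrow> ('p, 'q) cat \<Rightarrow>
    ('o, 'm, 'p, 'q) cat_functor \<Rightarrow> ('p, 'q, 'o, 'm) cat_functor \<Rightarrow> bool"
where
  "equivalence_of_categories C D F G \<longleftrightarrow>
    is_functor C D F \<and> is_functor D C G \<and>
    naturally_isomorphic C C id_functor (comp_functor G F) \<and>
    naturally_isomorphic D D (comp_functor F G) id_functor"

definition equivalent_categories :: "('o, 'm) cat \<Rightarrow> ('p, 'q) cat \<Rightarrow> bool" where
  "equivalent_categories C D \<longleftrightarrow> (\<exists>F G. equivalence_of_categories C D F G)"

definition self_dual :: "('o, 'm) cat \<Rightarrow> bool" where
  "self_dual C \<longleftrightarrow> equivalent_categories C (opposite C)"

text \<open>Functors and natural transformations that are themselves objects or arrows of a category are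
  normalised to be extensional, so that equality in HOL is equality of functors and of natural
  transformations. An arrow records its source and target functor.\<close>

definition functor_category ::
  "('o, 'm) cat \<Rightarrow> ('p, 'q) cat \<Rightarrow>
    (('o, 'm, 'p, 'q) cat_functor,
     ('o, 'm, 'p, 'q) cat_functor \<times> ('o \<Rightarrow> 'q) \<times> ('o, 'm, 'p, 'q) cat_functor) cat"
where
  "functor_category C D =
    (let Fun = {F. is_functor C D F \<and> on_obj F \<in> extensional (Obj C) \<and>
                   on_arr F \<in> extensional (Arr C)}
     in \<lparr>Obj = Fun,
         Arr = {(F, \<eta>, G). F \<in> Fun \<and> G \<in> Fun \<and> natural_transformation C D F G \<eta> \<and>
                            \<eta> \<in> extensional (Obj C)},
         Dom = (\<lambda>(F, \<eta>, G). F),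
         Cod = (\<lambda>(F, \<eta>, G). G),
         Id = (\<lambda>F. (F, \<lambda>X\<in>Obj C. Id D (on_obj F X), F)),
         Comp = (\<lambda>(G', \<theta>, H) (F, \<eta>, G). (F, \<lambda>X\<in>Obj C. Comp D (\<theta> X) (\<eta> X), H))\<rparr>)"

text \<open>\<open>pullback C H\<close> sends \<open>M\<close> to \<open>M \<circ> H\<close>, for a functor \<open>H\<close> defined on \<open>C\<close>.\<close>

definition pullback ::
  "('o, 'm) cat \<Rightarrow> ('o, 'm, 'p, 'q) cat_functor \<Rightarrow>
    (('p, 'q, 'r, 's) cat_functor,
     ('p, 'q, 'r, 's) cat_functor \<times> ('p \<Rightarrow> 's) \<times> ('p, 'q, 'r, 's) cat_functor,
     ('o, 'm, 'r, 's) cat_functor,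
     ('o, 'm, 'r, 's) cat_functor \<times> ('o \<Rightarrow> 's) \<times> ('o, 'm, 'r, 's) cat_functor) cat_functor"
where
  "pullback C H =
    (let pb = (\<lambda>M. \<lparr>on_obj = restrict (on_obj M \<circ> on_obj H) (Obj C),
                     on_arr = restrict (on_arr M \<circ> on_arr H) (Arr C)\<rparr>)
     in \<lparr>on_obj = pb,
         on_arr = (\<lambda>(M, \<eta>, N). (pb M, restrict (\<eta> \<circ> on_obj H) (Obj C), pb N))\<rparr>)"


section \<open>Finite dimensional complex vector spaces\<close>

text \<open>The type variable \<open>'v\<close> is the universe from which vectors are drawn. If it has at least the
  cardinality of the continuum, every finite dimensional complex vector space is isomorphic to an
  object of \<open>Vec\<close>. Records that differ only off the carrier, or in the unused ring fields \<open>mult\<close> and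
  \<open>one\<close>, are distinct isomorphic objects.\<close>

type_synonym 'v vec_obj = "(complex, 'v) module"
type_synonym 'v vec_arr = "'v vec_obj \<times> ('v \<Rightarrow> 'v) \<times> 'v vec_obj"

definition fin_dim_space :: "'v vec_obj \<Rightarrow> bool" where
  "fin_dim_space V \<longleftrightarrow> vectorspace class_ring V \<and> vectorspace.fin_dim class_ring V"

definition Vec :: "('v vec_obj, 'v vec_arr) cat" where
  "Vec = \<lparr>Obj = {V. fin_dim_space V},
          Arr = {(V, f, W). fin_dim_space V \<and> fin_dim_space W \<and>
                            linear_map class_ring V W f \<and> f \<in> extensional (carrier V)},
          Dom = (\<lambda>(V, f, W). V),
          Cod = (\<lambda>(V, f, W). W),
          Id = (\<lambda>V. (V, \<lambda>x\<in>carrier V. x, V)),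
          Comp = (\<lambda>(W', g, X) (V, f, W). (V, compose (carrier V) g f, X))\<rparr>"


section \<open>Weighted finite sets\<close>

text \<open>The tuple \<open>(S\<^sub>1, \<dots>, S\<^sub>n)\<close> is a list of length \<open>n\<close>; list positions start at 0, weights
  at 1. Elements are drawn from the type \<open>'a\<close>; if it is infinite, every weighted finite set
  occurs up to weight-preserving bijection.\<close>

type_synonym 'a wset = "'a set list"
type_synonym 'a wset_arr = "'a wset \<times> ('a \<Rightarrow> 'a) \<times> 'a wset"

definition weighted_set :: "nat \<Rightarrow> 'a wset \<Rightarrow> bool" where
  "weighted_set n S \<longleftrightarrow> length S = n \<and> (\<forall>i<n. finite (S ! i)) \<and>
    (\<forall>i<n. \<forall>j<n. i \<noteq> j \<longrightarrow> S ! i \<inter> S ! j = {})"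

definition elements :: "'a wset \<Rightarrow> 'a set" where
  "elements S = \<Union> (set S)"

definition weight :: "'a wset \<Rightarrow> 'a \<Rightarrow> nat" where
  "weight S x = (THE i. 1 \<le> i \<and> i \<le> length S \<and> x \<in> S ! (i - 1))"

definition weighted_bijections :: "nat \<Rightarrow> (nat \<Rightarrow> nat \<Rightarrow> bool) \<Rightarrow> ('a wset, 'a wset_arr) cat" where
  "weighted_bijections n R =
    \<lparr>Obj = {S. weighted_set n S},
     Arr = {(S, \<phi>, T). weighted_set n S \<and> weighted_set n T \<and>
                        bij_betw \<phi> (elements S) (elements T) \<and> \<phi> \<in> extensional (elements S) \<and>
                        (\<forall>x \<in> elements S. R (weight S x) (weight T (\<phi> x)))},
     Dom = (\<lambda>(S, \<phi>, T). S),
     Cod = (\<lambda>(S, \<phi>, T). T),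
     Id = (\<lambda>S. (S, \<lambda>x\<in>elements S. x, S)),
     Comp = (\<lambda>(T', \<psi>, U) (S, \<phi>, T). (S, compose (elements S) \<psi> \<phi>, U))\<rparr>"

definition U_cat :: "nat \<Rightarrow> ('a wset, 'a wset_arr) cat" where
  "U_cat n = weighted_bijections n (\<le>)"

definition D_cat :: "nat \<Rightarrow> ('a wset, 'a wset_arr) cat" where
  "D_cat n = weighted_bijections n (\<ge>)"


section \<open>Modules and weight reversal\<close>

type_synonym ('a, 'v) wset_functor = "('a wset, 'a wset_arr, 'v vec_obj, 'v vec_arr) cat_functor"
type_synonym ('a, 'v) wset_nat_trans =
  "('a, 'v) wset_functor \<times> ('a wset \<Rightarrow> 'v vec_arr) \<times> ('a, 'v) wset_functor"
type_synonym ('a, 'v) mod_cat = "(('a, 'v) wset_functor, ('a, 'v) wset_nat_trans) cat"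
type_synonym ('a, 'v) mod_functor =
  "(('a, 'v) wset_functor, ('a, 'v) wset_nat_trans,
    ('a, 'v) wset_functor, ('a, 'v) wset_nat_trans) cat_functor"

definition finitely_supported ::
  "('o, 'm) cat \<Rightarrow> ('o, 'm, 'v vec_obj, 'v vec_arr) cat_functor \<Rightarrow> bool"
where
  "finitely_supported C M \<longleftrightarrow>
    (\<exists>A. finite A \<and> A \<subseteq> Obj C \<and>
      (\<forall>S \<in> Obj C. carrier (on_obj M S) \<noteq> {\<zero>\<^bsub>on_obj M S\<^esub>} \<longrightarrow> (\<exists>T \<in> A. isomorphic C S T)))"

definition Mod_U :: "nat \<Rightarrow> ('a, 'v) mod_cat" where
  "Mod_U n = full_subcategory (functor_category (U_cat n) Vec) (finitely_supported (U_cat n))"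

definition Mod_D :: "nat \<Rightarrow> ('a, 'v) mod_cat" where
  "Mod_D n = full_subcategory (functor_category (D_cat n) Vec) (finitely_supported (D_cat n))"

text \<open>\<open>(S\<^sub>1, \<dots>, S\<^sub>n) \<mapsto> (S\<^sub>n, \<dots>, S\<^sub>1)\<close>, identity on underlying bijections. The same formula
  gives the functor \<open>\<tau>\<close> from \<open>U_cat n\<close> to \<open>D_cat n\<close> and its inverse.\<close>

definition tau :: "('a wset, 'a wset_arr, 'a wset, 'a wset_arr) cat_functor" where
  "tau = \<lparr>on_obj = rev, on_arr = (\<lambda>(S, \<phi>, T). (rev S, \<phi>, rev T))\<rparr>"

definition tau_shriek :: "nat \<Rightarrow> ('a, 'v) mod_functor" where
  "tau_shriek n = pullback (D_cat n) tau"

definition tau_star :: "nat \<Rightarrow> ('a, 'v) mod_functor" where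
  "tau_star n = pullback (U_cat n) tau"

lemma tau_shriek_on_obj:
  assumes "S \<in> Obj (D_cat n)"
  shows "on_obj (on_obj (tau_shriek n) M) S = on_obj M (rev S)"
  using assms by (simp add: tau_shriek_def pullback_def tau_def)

lemma tau_shriek_on_arr:
  assumes "(S, \<phi>, T) \<in> Arr (D_cat n)"
  shows "on_arr (on_obj (tau_shriek n) M) (S, \<phi>, T) = on_arr M (rev S, \<phi>, rev T)"
  using assms by (simp add: tau_shriek_def pullback_def tau_def)

end

theory Submission
  imports Defs
begin

text \<open>
  Reversing the list of weights turns \<open>\<le>\<close> into \<open>\<ge>\<close>, so \<open>\<tau>\<close> is an isomorphism from \<open>\<U>\<close> to \<open>\<D>\<close>, and
  its inverse is given by the same formula. Precomposition with a functor is functorial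
  (\<open>pullback_is_functor\<close>), and precompositions with mutually inverse functors are mutually inverse
  on the nose (\<open>pullback_inverse\<close>). An isomorphism of categories carries a finite set of
  representatives of the support of a module to one for the pulled back module
  (\<open>finitely_supported_transfer\<close>). This gives the first claim, with identities as unit and counit.

  For self-duality, two contravariant involutions are combined. On \<open>\<U>\<close>, inverting a bijection turns
  a morphism of \<open>\<U>\<close> into a morphism of \<open>\<D>\<close> in the other direction, and \<open>\<tau>\<close> brings it back to \<open>\<U>\<close>:
  a morphism \<open>\<phi> : S \<rightarrow> T\<close> yields \<open>\<phi>\<^sup>-\<^sup>1 : rev T \<rightarrow> rev S\<close>. On vector spaces one has linear duality. The dual
  of a module \<open>M\<close> sends \<open>S\<close> to the dual of \<open>M (rev S)\<close>, and \<open>\<phi>\<close> acts on it by the transpose of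
  \<open>M (\<phi>\<^sup>-\<^sup>1)\<close> (\<open>conjugate\<close>).

  The vectors of every space come from one type, so the dual has to be realised there. For this a
  symmetric bilinear form is chosen on every \<open>V\<close> that identifies \<open>V\<close> with its dual
  (\<open>perfect_symmetric_form_exists\<close>). Duality then becomes the identity on spaces and the transpose
  with respect to the chosen forms on maps. Since the forms are symmetric, transposing twice is the
  identity, not just naturally isomorphic to it. Both involutions being strict, the duality of
  modules is strictly involutive (\<open>conjugate_involution\<close>) and therefore is its own inverse.
\<close>

section \<open>Constructions on categories and functors\<close>

lemma Hom_Arr: "f \<in> Hom C X Y \<Longrightarrow> f \<in> Arr C"
  by (simp add: Hom_def)

lemma (in category) Arr_in_Hom: "f \<in> Arr C \<Longrightarrow> f \<in> Hom C (Dom C f) (Cod C f)"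
  by (simp add: Hom_def)

lemma (in category) Hom_Obj:
  assumes "f \<in> Hom C X Y"
  shows "X \<in> Obj C" "Y \<in> Obj C"
  using assms Dom_in_Obj Cod_in_Obj by (auto simp: Hom_def)

lemma (in category) Id_is_iso:
  assumes "X \<in> Obj C"
  shows "is_iso C (Id C X)"
  using Id_in_Hom[OF assms] Comp_Id_left[OF Id_in_Hom[OF assms]]
  unfolding is_iso_def by (auto simp: Hom_def)

text \<open>The identities are the components of the isomorphism. Agreement is asked only on the objects and
  arrows of \<open>C\<close>: off these sets functors take arbitrary values and need not be equal.\<close>

lemma naturally_isomorphic_if_equal:
  assumes F: "is_functor C D F" and G: "is_functor C D G"
    and obj: "\<And>X. X \<in> Obj C \<Longrightarrow> on_obj F X = on_obj G X"
    and arr: "\<And>f. f \<in> Arr C \<Longrightarrow> on_arr F f = on_arr G f"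
  shows "naturally_isomorphic C D F G"
proof -
  interpret F: is_functor C D F by (rule F)
  interpret G: is_functor C D G by (rule G)
  let ?\<eta> = "\<lambda>X. Id D (on_obj F X)"
  have "natural_transformation C D F G ?\<eta>"
  proof unfold_locales
    fix X assume "X \<in> Obj C"
    then show "?\<eta> X \<in> Hom D (on_obj F X) (on_obj G X)"
      using F.D.Id_in_Hom[OF F.on_obj_in_Obj] obj by simp
  next
    fix f X Y assume f: "f \<in> Hom C X Y"
    show "Comp D (?\<eta> Y) (on_arr F f) = Comp D (on_arr G f) (?\<eta> X)"
      using F.D.Comp_Id_left[OF F.on_arr_in_Hom[OF f]] F.D.Comp_Id_right[OF F.on_arr_in_Hom[OF f]]
        arr[OF Hom_Arr[OF f]] by simp
  qed
  then show ?thesis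
    unfolding naturally_isomorphic_def
    using F.D.Id_is_iso[OF F.on_obj_in_Obj] by blast
qed

lemma id_functor_is_functor: "category C \<Longrightarrow> is_functor C C id_functor"
  by (simp add: is_functor_def is_functor_axioms_def id_functor_def)

lemma comp_functor_is_functor:
  assumes F: "is_functor C D F" and G: "is_functor D E G"
  shows "is_functor C E (comp_functor G F)"
proof -
  interpret F: is_functor C D F by (rule F)
  interpret G: is_functor D E G by (rule G)
  show ?thesis
    by unfold_locales
      (simp_all add: comp_functor_def F.on_obj_in_Obj G.on_obj_in_Obj F.on_arr_in_Hom
        G.on_arr_in_Hom F.on_arr_Id G.on_arr_Id F.on_arr_Comp
        G.on_arr_Comp[OF F.on_arr_in_Hom F.on_arr_in_Hom])
qed

lemma equivalence_if_strict_inverse: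
  assumes F: "is_functor C D F" and G: "is_functor D C G"
    and GF_obj: "\<And>X. X \<in> Obj C \<Longrightarrow> on_obj G (on_obj F X) = X"
    and GF_arr: "\<And>f. f \<in> Arr C \<Longrightarrow> on_arr G (on_arr F f) = f"
    and FG_obj: "\<And>X. X \<in> Obj D \<Longrightarrow> on_obj F (on_obj G X) = X"
    and FG_arr: "\<And>f. f \<in> Arr D \<Longrightarrow> on_arr F (on_arr G f) = f"
  shows "equivalence_of_categories C D F G"
proof -
  have C: "category C" and D: "category D"
    using F by (auto simp: is_functor_def)
  have "naturally_isomorphic C C id_functor (comp_functor G F)"
    by (rule naturally_isomorphic_if_equal
        [OF id_functor_is_functor[OF C] comp_functor_is_functor[OF F G]])
      (simp_all add: id_functor_def comp_functor_def GF_obj GF_arr)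
  moreover have "naturally_isomorphic D D (comp_functor F G) id_functor"
    by (rule naturally_isomorphic_if_equal
        [OF comp_functor_is_functor[OF G F] id_functor_is_functor[OF D]])
      (simp_all add: id_functor_def comp_functor_def FG_obj FG_arr)
  ultimately show ?thesis
    using F G by (simp add: equivalence_of_categories_def)
qed

lemma opposite_simps [simp]:
  "Obj (opposite C) = Obj C" "Arr (opposite C) = Arr C"
  "Dom (opposite C) = Cod C" "Cod (opposite C) = Dom C"
  "Id (opposite C) = Id C" "Comp (opposite C) g f = Comp C f g"
  by (simp_all add: opposite_def)

lemma Hom_opposite [simp]: "Hom (opposite C) X Y = Hom C Y X"
  by (auto simp: Hom_def)

lemma opposite_opposite [simp]: "opposite (opposite C) = (C :: ('o, 'm) cat)"
  by (simp add: opposite_def)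

lemma category_opposite:
  assumes "category C"
  shows "category (opposite C)"
proof -
  interpret category C by (rule assms)
  show ?thesis
    by unfold_locales
      (simp_all add: Dom_in_Obj Cod_in_Obj Id_in_Hom Comp_in_Hom Comp_Id_right Comp_Id_left
        Comp_assoc)
qed

text \<open>In particular a functor from \<open>C\<close> to \<open>opposite C\<close> is, as the same record, also a functor from
  \<open>opposite C\<close> to \<open>C\<close>, so it can serve as its own inverse.\<close>

lemma is_functor_opposite:
  assumes "is_functor C D F"
  shows "is_functor (opposite C) (opposite D) F"
proof -
  interpret is_functor C D F by (rule assms)
  interpret Co: category "opposite C" by (rule category_opposite[OF C.category_axioms])
  interpret Do: category "opposite D" by (rule category_opposite[OF D.category_axioms])
  show ?thesis
    by unfold_locales (simp_all add: on_obj_in_Obj on_arr_in_Hom on_arr_Id on_arr_Comp)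
qed

lemma self_dual_if_involution:
  assumes F: "is_functor C (opposite C) F"
    and obj: "\<And>X. X \<in> Obj C \<Longrightarrow> on_obj F (on_obj F X) = X"
    and arr: "\<And>f. f \<in> Arr C \<Longrightarrow> on_arr F (on_arr F f) = f"
  shows "self_dual C"
proof -
  have "is_functor (opposite C) C F"
    using is_functor_opposite[OF F] by simp
  then have "equivalence_of_categories C (opposite C) F F"
    using F by (intro equivalence_if_strict_inverse) (simp_all add: obj arr)
  then show ?thesis
    by (auto simp: self_dual_def equivalent_categories_def)
qed

lemma full_subcategory_simps [simp]:
  "Obj (full_subcategory C P) = {X \<in> Obj C. P X}"
  "Arr (full_subcategory C P) = {f \<in> Arr C. P (Dom C f) \<and> P (Cod C f)}"
  "Dom (full_subcategory C P) = Dom C" "Cod (full_subcategory C P) = Cod C"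
  "Id (full_subcategory C P) = Id C" "Comp (full_subcategory C P) = Comp C"
  by (simp_all add: full_subcategory_def)

lemma Hom_full_subcategory:
  "f \<in> Hom (full_subcategory C P) X Y \<longleftrightarrow> f \<in> Hom C X Y \<and> P X \<and> P Y"
  by (auto simp: Hom_def)

lemma category_full_subcategory:
  assumes "category C"
  shows "category (full_subcategory C P)"
proof -
  interpret category C by (rule assms)
  show ?thesis
    by unfold_locales
      (auto simp: Hom_full_subcategory Dom_in_Obj Cod_in_Obj Id_in_Hom
        intro: Comp_in_Hom Comp_Id_right Comp_Id_left Comp_assoc)
qed

lemma full_subcategory_opposite:
  "full_subcategory (opposite C) P = opposite (full_subcategory (C :: ('o, 'm) cat) P)"
  by (auto simp: full_subcategory_def opposite_def)

lemma is_functor_full_subcategory: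
  assumes F: "is_functor C D F"
    and P: "\<And>X. X \<in> Obj C \<Longrightarrow> P X \<Longrightarrow> Q (on_obj F X)"
  shows "is_functor (full_subcategory C P) (full_subcategory D Q) F"
proof -
  interpret is_functor C D F by (rule F)
  interpret C': category "full_subcategory C P"
    by (rule category_full_subcategory[OF C.category_axioms])
  interpret D': category "full_subcategory D Q"
    by (rule category_full_subcategory[OF D.category_axioms])
  show ?thesis
  proof unfold_locales
    fix f X Y assume f: "f \<in> Hom (full_subcategory C P) X Y"
    then show "on_arr F f \<in> Hom (full_subcategory D Q) (on_obj F X) (on_obj F Y)"
      using C.Hom_Obj[of f X Y] by (auto simp: Hom_full_subcategory on_arr_in_Hom P)
  qed (auto simp: Hom_full_subcategory on_obj_in_Obj on_arr_Id on_arr_Comp P)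
qed

lemma is_functor_isomorphic:
  assumes F: "is_functor C D F" and iso: "isomorphic C X Y"
  shows "isomorphic D (on_obj F X) (on_obj F Y)"
proof -
  interpret is_functor C D F by (rule F)
  obtain f g where f: "f \<in> Hom C X Y" and g: "g \<in> Hom C Y X"
    and gf: "Comp C g f = Id C X" and fg: "Comp C f g = Id C Y"
    using iso by (auto simp: isomorphic_def is_iso_def Hom_def)
  have "Comp D (on_arr F g) (on_arr F f) = Id D (on_obj F X)"
    "Comp D (on_arr F f) (on_arr F g) = Id D (on_obj F Y)"
    using on_arr_Comp[OF f g] on_arr_Comp[OF g f] gf fg on_arr_Id C.Hom_Obj[OF f] by auto
  then show ?thesis
    using on_arr_in_Hom[OF f] on_arr_in_Hom[OF g]
    unfolding isomorphic_def is_iso_def by (auto simp: Hom_def)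
qed

lemma isomorphic_opposite: "isomorphic (opposite C) X Y \<longleftrightarrow> isomorphic C X Y"
  by (auto simp: isomorphic_def is_iso_def Hom_def)


section \<open>Functor categories\<close>

lemma functor_category_Obj:
  "F \<in> Obj (functor_category C D) \<longleftrightarrow>
    is_functor C D F \<and> on_obj F \<in> extensional (Obj C) \<and> on_arr F \<in> extensional (Arr C)"
  by (simp add: functor_category_def Let_def)

lemma functor_category_Arr:
  "(F, \<eta>, G) \<in> Arr (functor_category C D) \<longleftrightarrow>
    F \<in> Obj (functor_category C D) \<and> G \<in> Obj (functor_category C D) \<and>
    natural_transformation C D F G \<eta> \<and> \<eta> \<in> extensional (Obj C)"
  by (simp add: functor_category_def Let_def)

lemma functor_category_simps [simp]:
  "Dom (functor_category C D) (F, \<eta>, G) = F"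
  "Cod (functor_category C D) (F, \<eta>, G) = G"
  "Id (functor_category C D) F = (F, \<lambda>X\<in>Obj C. Id D (on_obj F X), F)"
  "Comp (functor_category C D) (G', \<theta>, H) (F, \<eta>, G) = (F, \<lambda>X\<in>Obj C. Comp D (\<theta> X) (\<eta> X), H)"
  by (simp_all add: functor_category_def Let_def)

lemma functor_category_Hom:
  "A \<in> Hom (functor_category C D) F G \<longleftrightarrow>
    (\<exists>\<eta>. A = (F, \<eta>, G) \<and> (F, \<eta>, G) \<in> Arr (functor_category C D))"
  by (cases A) (auto simp: Hom_def)

text \<open>Compared with the introduction rule of the locale, the naturality square may be checked with the
  endpoints known to be objects, which unfolds components that are restricted to the objects.\<close>

lemma natural_transformationI:
  assumes "is_functor C D F" "is_functor C D G"
    and "\<And>X. X \<in> Obj C \<Longrightarrow> \<eta> X \<in> Hom D (on_obj F X) (on_obj G X)"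
    and "\<And>f X Y. f \<in> Hom C X Y \<Longrightarrow> X \<in> Obj C \<Longrightarrow> Y \<in> Obj C \<Longrightarrow>
      Comp D (\<eta> Y) (on_arr F f) = Comp D (on_arr G f) (\<eta> X)"
  shows "natural_transformation C D F G \<eta>"
proof -
  interpret F: is_functor C D F by (rule assms)
  interpret G: is_functor C D G by (rule assms)
  show ?thesis
    using assms(3,4) F.C.Hom_Obj by unfold_locales blast+
qed

lemma category_functor_category:
  assumes C: "category C" and D: "category D"
  shows "category (functor_category C D)"
proof -
  interpret C: category C by (rule C)
  interpret D: category D by (rule D)
  let ?F = "functor_category C D"
  have component: "\<eta> X \<in> Hom D (on_obj F X) (on_obj G X)"
    if "(F, \<eta>, G) \<in> Arr ?F" "X \<in> Obj C" for F \<eta> G X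
    using that natural_transformation.component_in_Hom[of C D F G \<eta> X]
    by (simp add: functor_category_Arr)
  show ?thesis
  proof
    fix A assume "A \<in> Arr ?F"
    then show "Dom ?F A \<in> Obj ?F" "Cod ?F A \<in> Obj ?F"
      by (cases A, simp add: functor_category_Arr)+
  next
    fix F assume F: "F \<in> Obj ?F"
    then interpret F: is_functor C D F by (simp add: functor_category_Obj)
    have "natural_transformation C D F F (\<lambda>X\<in>Obj C. Id D (on_obj F X))"
      by (rule natural_transformationI)
        (auto simp: F.is_functor_axioms D.Id_in_Hom F.on_obj_in_Obj
          D.Comp_Id_left[OF F.on_arr_in_Hom] D.Comp_Id_right[OF F.on_arr_in_Hom])
    then show "Id ?F F \<in> Hom ?F F F"
      using F by (simp add: functor_category_Hom functor_category_Arr)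
  next
    fix A B F G H assume "A \<in> Hom ?F F G" "B \<in> Hom ?F G H"
    then obtain \<eta> \<theta> where A: "A = (F, \<eta>, G)" "(F, \<eta>, G) \<in> Arr ?F"
      and B: "B = (G, \<theta>, H)" "(G, \<theta>, H) \<in> Arr ?F"
      by (auto simp: functor_category_Hom)
    interpret \<eta>: natural_transformation C D F G \<eta> using A by (simp add: functor_category_Arr)
    interpret \<theta>: natural_transformation C D G H \<theta> using B by (simp add: functor_category_Arr)
    have "natural_transformation C D F H (\<lambda>X\<in>Obj C. Comp D (\<theta> X) (\<eta> X))"
    proof (rule natural_transformationI)
      fix f X Y assume f: "f \<in> Hom C X Y" and X: "X \<in> Obj C" and Y: "Y \<in> Obj C"
      note \<eta>X = \<eta>.component_in_Hom[OF X] and \<eta>Y = \<eta>.component_in_Hom[OF Y]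
        and \<theta>X = \<theta>.component_in_Hom[OF X] and \<theta>Y = \<theta>.component_in_Hom[OF Y]
        and Ff = \<eta>.F.on_arr_in_Hom[OF f] and Gf = \<eta>.G.on_arr_in_Hom[OF f]
        and Hf = \<theta>.G.on_arr_in_Hom[OF f]
      have "Comp D (Comp D (\<theta> Y) (\<eta> Y)) (on_arr F f) = Comp D (\<theta> Y) (Comp D (on_arr G f) (\<eta> X))"
        using D.Comp_assoc[OF Ff \<eta>Y \<theta>Y] \<eta>.naturality[OF f] by simp
      also have "\<dots> = Comp D (on_arr H f) (Comp D (\<theta> X) (\<eta> X))"
        using D.Comp_assoc[OF \<eta>X Gf \<theta>Y] \<theta>.naturality[OF f] D.Comp_assoc[OF \<eta>X \<theta>X Hf] by simp
      finally show "Comp D ((\<lambda>X\<in>Obj C. Comp D (\<theta> X) (\<eta> X)) Y) (on_arr F f) =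
          Comp D (on_arr H f) ((\<lambda>X\<in>Obj C. Comp D (\<theta> X) (\<eta> X)) X)"
        using X Y by simp
    qed (auto simp: \<eta>.F.is_functor_axioms \<theta>.G.is_functor_axioms
        intro: D.Comp_in_Hom[OF \<eta>.component_in_Hom \<theta>.component_in_Hom])
    then show "Comp ?F B A \<in> Hom ?F F H"
      using A B by (simp add: functor_category_Hom functor_category_Arr)
  next
    fix A F G assume "A \<in> Hom ?F F G"
    then obtain \<eta> where A: "A = (F, \<eta>, G)" "(F, \<eta>, G) \<in> Arr ?F"
      by (auto simp: functor_category_Hom)
    then have ext: "\<eta> \<in> extensional (Obj C)"
      by (simp add: functor_category_Arr)
    have "(\<lambda>X\<in>Obj C. Comp D (\<eta> X) ((\<lambda>X\<in>Obj C. Id D (on_obj F X)) X)) = \<eta>"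
      "(\<lambda>X\<in>Obj C. Comp D ((\<lambda>X\<in>Obj C. Id D (on_obj G X)) X) (\<eta> X)) = \<eta>"
      using ext component[OF A(2)]
      by (auto intro!: extensionalityI[where A = "Obj C"] D.Comp_Id_right D.Comp_Id_left)
    then show "Comp ?F A (Id ?F F) = A" "Comp ?F (Id ?F G) A = A"
      using A by simp_all
  next
    fix A1 A2 A3 F G H K
    assume "A1 \<in> Hom ?F F G" "A2 \<in> Hom ?F G H" "A3 \<in> Hom ?F H K"
    then obtain \<eta> \<theta> \<kappa> where A: "A1 = (F, \<eta>, G)" "(F, \<eta>, G) \<in> Arr ?F"
      "A2 = (G, \<theta>, H)" "(G, \<theta>, H) \<in> Arr ?F" "A3 = (H, \<kappa>, K)" "(H, \<kappa>, K) \<in> Arr ?F"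
      by (auto simp: functor_category_Hom)
    have "Comp D (\<kappa> X) (Comp D (\<theta> X) (\<eta> X)) = Comp D (Comp D (\<kappa> X) (\<theta> X)) (\<eta> X)"
      if X: "X \<in> Obj C" for X
      by (rule D.Comp_assoc[OF component[OF A(2) X] component[OF A(4) X] component[OF A(6) X]])
    then show "Comp ?F A3 (Comp ?F A2 A1) = Comp ?F (Comp ?F A3 A2) A1"
      using A by (simp cong: restrict_cong)
  qed
qed

text \<open>Extensionality of the objects of a functor category is what makes strict inverses possible:
  functors that agree on \<open>C\<close> are equal.\<close>

lemma functor_category_Obj_eqI:
  fixes M N :: "('o, 'm, 'p, 'q) cat_functor"
  assumes "M \<in> Obj (functor_category C D)" "N \<in> Obj (functor_category C D)"
    and "\<And>X. X \<in> Obj C \<Longrightarrow> on_obj M X = on_obj N X"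
    and "\<And>f. f \<in> Arr C \<Longrightarrow> on_arr M f = on_arr N f"
  shows "M = N"
proof -
  have "on_obj M = on_obj N"
    using assms by (intro extensionalityI[where A = "Obj C"]) (auto simp: functor_category_Obj)
  moreover have "on_arr M = on_arr N"
    using assms by (intro extensionalityI[where A = "Arr C"]) (auto simp: functor_category_Obj)
  ultimately show ?thesis by simp
qed

lemma pullback_on_obj:
  "X \<in> Obj C \<Longrightarrow> on_obj (on_obj (pullback C H) M) X = on_obj M (on_obj H X)"
  "f \<in> Arr C \<Longrightarrow> on_arr (on_obj (pullback C H) M) f = on_arr M (on_arr H f)"
  by (simp_all add: pullback_def Let_def)

lemma pullback_on_arr:
  "on_arr (pullback C H) (M, \<eta>, N) =
    (on_obj (pullback C H) M, \<lambda>X\<in>Obj C. \<eta> (on_obj H X), on_obj (pullback C H) N)"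
  by (simp add: pullback_def Let_def comp_def)

text \<open>Whiskering with \<open>H\<close>: composites of functors are functors, and \<open>\<eta>\<close> is natural at the arrows
  \<open>H f\<close> in particular. The rest is bookkeeping with the restrictions to \<open>C\<close>.\<close>

lemma pullback_is_functor:
  assumes H: "is_functor C D H" and E: "category E"
  shows "is_functor (functor_category D E) (functor_category C E) (pullback C H)"
proof -
  interpret H: is_functor C D H by (rule H)
  interpret DE: category "functor_category D E"
    by (rule category_functor_category[OF H.D.category_axioms E])
  interpret CE: category "functor_category C E"
    by (rule category_functor_category[OF H.C.category_axioms E])
  let ?P = "pullback C H"
  have obj: "on_obj ?P M \<in> Obj (functor_category C E)"
    if M: "M \<in> Obj (functor_category D E)" for M
  proof -
    interpret M: is_functor D E M using M by (simp add: functor_category_Obj)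
    have "is_functor C E (on_obj ?P M)"
    proof unfold_locales
      fix f X Y assume f: "f \<in> Hom C X Y"
      then show "on_arr (on_obj ?P M) f \<in> Hom E (on_obj (on_obj ?P M) X) (on_obj (on_obj ?P M) Y)"
        using M.on_arr_in_Hom[OF H.on_arr_in_Hom[OF f]] H.C.Hom_Obj[OF f]
        by (simp add: pullback_on_obj Hom_Arr)
      fix g Z assume g: "g \<in> Hom C Y Z"
      show "on_arr (on_obj ?P M) (Comp C g f) =
          Comp E (on_arr (on_obj ?P M) g) (on_arr (on_obj ?P M) f)"
        using Hom_Arr[OF f] Hom_Arr[OF g] Hom_Arr[OF H.C.Comp_in_Hom[OF f g]]
        by (simp add: pullback_on_obj H.on_arr_Comp[OF f g]
            M.on_arr_Comp[OF H.on_arr_in_Hom[OF f] H.on_arr_in_Hom[OF g]])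
    qed (simp_all add: pullback_on_obj M.on_obj_in_Obj H.on_obj_in_Obj
        Hom_Arr[OF H.C.Id_in_Hom] H.on_arr_Id M.on_arr_Id)
    then show ?thesis
      by (simp add: functor_category_Obj) (simp add: pullback_def Let_def)
  qed
  show ?thesis
  proof unfold_locales
    fix A M N assume "A \<in> Hom (functor_category D E) M N"
    then obtain \<eta> where A: "A = (M, \<eta>, N)" "(M, \<eta>, N) \<in> Arr (functor_category D E)"
      by (auto simp: functor_category_Hom)
    interpret natural_transformation D E M N \<eta> using A by (simp add: functor_category_Arr)
    have M: "M \<in> Obj (functor_category D E)" and N: "N \<in> Obj (functor_category D E)"
      using A by (simp_all add: functor_category_Arr)
    have "natural_transformation C E (on_obj ?P M) (on_obj ?P N) (\<lambda>X\<in>Obj C. \<eta> (on_obj H X))"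
    proof (rule natural_transformationI)
      fix f X Y assume f: "f \<in> Hom C X Y" and XY: "X \<in> Obj C" "Y \<in> Obj C"
      then show "Comp E ((\<lambda>X\<in>Obj C. \<eta> (on_obj H X)) Y) (on_arr (on_obj ?P M) f) =
          Comp E (on_arr (on_obj ?P N) f) ((\<lambda>X\<in>Obj C. \<eta> (on_obj H X)) X)"
        using naturality[OF H.on_arr_in_Hom[OF f]] by (simp add: pullback_on_obj Hom_Arr)
    qed (use obj[OF M] obj[OF N] in
        \<open>auto simp: functor_category_Obj pullback_on_obj component_in_Hom H.on_obj_in_Obj\<close>)
    then show "on_arr ?P A \<in> Hom (functor_category C E) (on_obj ?P M) (on_obj ?P N)"
      using obj[OF M] obj[OF N] A(1)
      by (simp add: pullback_on_arr functor_category_Hom functor_category_Arr)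
    fix B K assume "B \<in> Hom (functor_category D E) N K"
    then obtain \<theta> where B: "B = (N, \<theta>, K)"
      by (auto simp: functor_category_Hom)
    show "on_arr ?P (Comp (functor_category D E) B A) =
        Comp (functor_category C E) (on_arr ?P B) (on_arr ?P A)"
      by (simp add: A(1) B pullback_on_arr H.on_obj_in_Obj cong: restrict_cong)
  qed (simp_all add: obj pullback_on_arr pullback_on_obj H.on_obj_in_Obj cong: restrict_cong)
qed

text \<open>\<open>(M \<circ> H) \<circ> K = M \<circ> (H \<circ> K)\<close>, and \<open>H \<circ> K\<close> is the identity on \<open>D\<close>.\<close>

lemma pullback_inverse:
  assumes H: "is_functor C D H" and K: "is_functor D C K" and E: "category E"
    and obj: "\<And>X. X \<in> Obj D \<Longrightarrow> on_obj H (on_obj K X) = X"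
    and arr: "\<And>f. f \<in> Arr D \<Longrightarrow> on_arr H (on_arr K f) = f"
  shows "M \<in> Obj (functor_category D E) \<Longrightarrow> on_obj (pullback D K) (on_obj (pullback C H) M) = M"
    and "A \<in> Arr (functor_category D E) \<Longrightarrow> on_arr (pullback D K) (on_arr (pullback C H) A) = A"
proof -
  interpret H: is_functor C D H by (rule H)
  interpret K: is_functor D C K by (rule K)
  interpret PH: is_functor "functor_category D E" "functor_category C E" "pullback C H"
    by (rule pullback_is_functor[OF H E])
  interpret PK: is_functor "functor_category C E" "functor_category D E" "pullback D K"
    by (rule pullback_is_functor[OF K E])
  have K_arr: "on_arr K f \<in> Arr C" if "f \<in> Arr D" for f
    by (rule Hom_Arr[OF K.on_arr_in_Hom[OF H.D.Arr_in_Hom[OF that]]])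
  show *: "on_obj (pullback D K) (on_obj (pullback C H) M) = M"
    if "M \<in> Obj (functor_category D E)" for M
    by (rule functor_category_Obj_eqI[OF PK.on_obj_in_Obj[OF PH.on_obj_in_Obj[OF that]] that])
      (simp_all add: pullback_on_obj K.on_obj_in_Obj K_arr obj arr)
  assume A: "A \<in> Arr (functor_category D E)"
  obtain M \<eta> N where M: "A = (M, \<eta>, N)" by (cases A)
  have "(\<lambda>X\<in>Obj D. (\<lambda>Y\<in>Obj C. \<eta> (on_obj H Y)) (on_obj K X)) = \<eta>"
    using A M by (intro extensionalityI[where A = "Obj D"])
      (auto simp: functor_category_Arr K.on_obj_in_Obj obj)
  then show "on_arr (pullback D K) (on_arr (pullback C H) A) = A"
    using A M by (simp add: pullback_on_arr functor_category_Arr *)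
qed

text \<open>For contravariant endofunctors \<open>H\<close> of \<open>C\<close> and \<open>T\<close> of the target category, the composite
  \<open>T \<circ> M \<circ> H\<close> is again covariant, whereas a transformation \<open>M \<rightarrow> N\<close> is sent to one from the conjugate
  of \<open>N\<close> to the conjugate of \<open>M\<close>.\<close>

definition conjugate ::
  "('o, 'm) cat \<Rightarrow> ('o, 'm, 'o, 'm) cat_functor \<Rightarrow> ('p, 'q, 'p, 'q) cat_functor \<Rightarrow>
    (('o, 'm, 'p, 'q) cat_functor,
     ('o, 'm, 'p, 'q) cat_functor \<times> ('o \<Rightarrow> 'q) \<times> ('o, 'm, 'p, 'q) cat_functor,
     ('o, 'm, 'p, 'q) cat_functor,
     ('o, 'm, 'p, 'q) cat_functor \<times> ('o \<Rightarrow> 'q) \<times> ('o, 'm, 'p, 'q) cat_functor) cat_functor"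
where
  "conjugate C H T =
    (let conj = (\<lambda>M. \<lparr>on_obj = (\<lambda>X\<in>Obj C. on_obj T (on_obj M (on_obj H X))),
                       on_arr = (\<lambda>f\<in>Arr C. on_arr T (on_arr M (on_arr H f)))\<rparr>)
     in \<lparr>on_obj = conj,
         on_arr = (\<lambda>(M, \<eta>, N). (conj N, \<lambda>X\<in>Obj C. on_arr T (\<eta> (on_obj H X)), conj M))\<rparr>)"

lemma conjugate_on_obj:
  "X \<in> Obj C \<Longrightarrow> on_obj (on_obj (conjugate C H T) M) X = on_obj T (on_obj M (on_obj H X))"
  "f \<in> Arr C \<Longrightarrow> on_arr (on_obj (conjugate C H T) M) f = on_arr T (on_arr M (on_arr H f))"
  by (simp_all add: conjugate_def Let_def)

lemma conjugate_on_arr: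
  "on_arr (conjugate C H T) (M, \<eta>, N) =
    (on_obj (conjugate C H T) N, \<lambda>X\<in>Obj C. on_arr T (\<eta> (on_obj H X)),
     on_obj (conjugate C H T) M)"
  by (simp add: conjugate_def Let_def)

text \<open>The naturality square of the image of \<open>\<eta>\<close> at \<open>f\<close> is the image under \<open>T\<close> of the square of \<open>\<eta>\<close> at
  \<open>H f\<close>; reversing the arrows twice puts it into the right shape.\<close>

lemma conjugate_is_functor:
  assumes H: "is_functor C (opposite C) H" and T: "is_functor E (opposite E) T"
  shows "is_functor (functor_category C E) (opposite (functor_category C E)) (conjugate C H T)"
proof -
  interpret H: is_functor C "opposite C" H by (rule H)
  interpret T: is_functor E "opposite E" T by (rule T)
  \<comment> \<open>The properties of \<open>H\<close> and \<open>T\<close>, with the opposite categories spelled out.\<close>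
  have H_Hom: "on_arr H f \<in> Hom C (on_obj H Y) (on_obj H X)" if "f \<in> Hom C X Y" for f X Y
    using H.on_arr_in_Hom[OF that] by simp
  have T_Hom: "on_arr T f \<in> Hom E (on_obj T Y) (on_obj T X)" if "f \<in> Hom E X Y" for f X Y
    using T.on_arr_in_Hom[OF that] by simp
  have H_Obj: "on_obj H X \<in> Obj C" if "X \<in> Obj C" for X
    using H.on_obj_in_Obj[OF that] by simp
  have T_Obj: "on_obj T X \<in> Obj E" if "X \<in> Obj E" for X
    using T.on_obj_in_Obj[OF that] by simp
  have H_Comp: "on_arr H (Comp C g f) = Comp C (on_arr H f) (on_arr H g)"
    if "f \<in> Hom C X Y" "g \<in> Hom C Y Z" for f g X Y Z
    using H.on_arr_Comp[OF that] by simp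
  have T_Comp: "on_arr T (Comp E g f) = Comp E (on_arr T f) (on_arr T g)"
    if "f \<in> Hom E X Y" "g \<in> Hom E Y Z" for f g X Y Z
    using T.on_arr_Comp[OF that] by simp
  interpret CE: category "functor_category C E"
    by (rule category_functor_category[OF H.C.category_axioms T.C.category_axioms])
  interpret CE': category "opposite (functor_category C E)"
    by (rule category_opposite[OF CE.category_axioms])
  let ?J = "conjugate C H T"
  have obj: "on_obj ?J M \<in> Obj (functor_category C E)"
    if M: "M \<in> Obj (functor_category C E)" for M
  proof -
    interpret M: is_functor C E M using M by (simp add: functor_category_Obj)
    have "is_functor C E (on_obj ?J M)"
    proof unfold_locales
      fix f X Y assume f: "f \<in> Hom C X Y"
      then show "on_arr (on_obj ?J M) f \<in> Hom E (on_obj (on_obj ?J M) X) (on_obj (on_obj ?J M) Y)"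
        using T_Hom[OF M.on_arr_in_Hom[OF H_Hom[OF f]]] H.C.Hom_Obj[OF f]
        by (simp add: conjugate_on_obj Hom_Arr)
      fix g Z assume g: "g \<in> Hom C Y Z"
      show "on_arr (on_obj ?J M) (Comp C g f) =
          Comp E (on_arr (on_obj ?J M) g) (on_arr (on_obj ?J M) f)"
        using Hom_Arr[OF f] Hom_Arr[OF g] Hom_Arr[OF H.C.Comp_in_Hom[OF f g]]
        by (simp add: conjugate_on_obj H_Comp[OF f g] M.on_arr_Comp[OF H_Hom[OF g] H_Hom[OF f]]
            T_Comp[OF M.on_arr_in_Hom[OF H_Hom[OF g]] M.on_arr_in_Hom[OF H_Hom[OF f]]])
    next
      fix X assume "X \<in> Obj C"
      then show "on_arr (on_obj ?J M) (Id C X) = Id E (on_obj (on_obj ?J M) X)"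
        using H.on_arr_Id T.on_arr_Id
        by (simp add: conjugate_on_obj Hom_Arr[OF H.C.Id_in_Hom] M.on_arr_Id H_Obj M.on_obj_in_Obj)
    qed (simp_all add: conjugate_on_obj M.on_obj_in_Obj H_Obj T_Obj)
    then show ?thesis
      by (simp add: functor_category_Obj) (simp add: conjugate_def Let_def)
  qed
  show ?thesis
  proof unfold_locales
    fix A M N assume "A \<in> Hom (functor_category C E) M N"
    then obtain \<eta> where A: "A = (M, \<eta>, N)" "(M, \<eta>, N) \<in> Arr (functor_category C E)"
      by (auto simp: functor_category_Hom)
    interpret \<eta>: natural_transformation C E M N \<eta> using A by (simp add: functor_category_Arr)
    have M: "M \<in> Obj (functor_category C E)" and N: "N \<in> Obj (functor_category C E)"
      using A by (simp_all add: functor_category_Arr)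
    let ?\<eta> = "\<lambda>X\<in>Obj C. on_arr T (\<eta> (on_obj H X))"
    have "natural_transformation C E (on_obj ?J N) (on_obj ?J M) ?\<eta>"
    proof (rule natural_transformationI)
      fix f X Y assume f: "f \<in> Hom C X Y" and X: "X \<in> Obj C" and Y: "Y \<in> Obj C"
      have "Comp E (on_arr T (\<eta> (on_obj H Y))) (on_arr T (on_arr N (on_arr H f))) =
          on_arr T (Comp E (on_arr N (on_arr H f)) (\<eta> (on_obj H Y)))"
        using T_Comp[OF \<eta>.component_in_Hom[OF H_Obj[OF Y]] \<eta>.G.on_arr_in_Hom[OF H_Hom[OF f]]]
        by simp
      also have "\<dots> = on_arr T (Comp E (\<eta> (on_obj H X)) (on_arr M (on_arr H f)))"
        using \<eta>.naturality[OF H_Hom[OF f]] by simp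
      also have "\<dots> = Comp E (on_arr T (on_arr M (on_arr H f))) (on_arr T (\<eta> (on_obj H X)))"
        by (rule T_Comp[OF \<eta>.F.on_arr_in_Hom[OF H_Hom[OF f]] \<eta>.component_in_Hom[OF H_Obj[OF X]]])
      finally show "Comp E (?\<eta> Y) (on_arr (on_obj ?J N) f) =
          Comp E (on_arr (on_obj ?J M) f) (?\<eta> X)"
        using X Y f by (simp add: conjugate_on_obj Hom_Arr)
    qed (use obj[OF M] obj[OF N] in
        \<open>auto simp: functor_category_Obj conjugate_on_obj
          intro: T_Hom \<eta>.component_in_Hom H_Obj\<close>)
    then show "on_arr ?J A \<in> Hom (opposite (functor_category C E)) (on_obj ?J M) (on_obj ?J N)"
      using obj[OF M] obj[OF N] A(1)
      by (simp add: conjugate_on_arr functor_category_Hom functor_category_Arr)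
    fix B K assume "B \<in> Hom (functor_category C E) N K"
    then obtain \<theta> where B: "B = (N, \<theta>, K)" "(N, \<theta>, K) \<in> Arr (functor_category C E)"
      by (auto simp: functor_category_Hom)
    interpret \<theta>: natural_transformation C E N K \<theta> using B by (simp add: functor_category_Arr)
    show "on_arr ?J (Comp (functor_category C E) B A) =
        Comp (opposite (functor_category C E)) (on_arr ?J B) (on_arr ?J A)"
      using T_Comp[OF \<eta>.component_in_Hom \<theta>.component_in_Hom]
      by (simp add: A(1) B(1) conjugate_on_arr H_Obj cong: restrict_cong)
  next
    fix M assume "M \<in> Obj (functor_category C E)"
    then interpret M: is_functor C E M by (simp add: functor_category_Obj)
    show "on_arr ?J (Id (functor_category C E) M) =
        Id (opposite (functor_category C E)) (on_obj ?J M)"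
      using T.on_arr_Id
      by (simp add: conjugate_on_arr conjugate_on_obj H_Obj M.on_obj_in_Obj cong: restrict_cong)
  qed (simp_all add: obj)
qed

lemma conjugate_involution:
  assumes H: "is_functor C (opposite C) H" and T: "is_functor E (opposite E) T"
    and H_obj: "\<And>X. X \<in> Obj C \<Longrightarrow> on_obj H (on_obj H X) = X"
    and H_arr: "\<And>f. f \<in> Arr C \<Longrightarrow> on_arr H (on_arr H f) = f"
    and T_obj: "\<And>X. X \<in> Obj E \<Longrightarrow> on_obj T (on_obj T X) = X"
    and T_arr: "\<And>f. f \<in> Arr E \<Longrightarrow> on_arr T (on_arr T f) = f"
  shows "M \<in> Obj (functor_category C E) \<Longrightarrow>
      on_obj (conjugate C H T) (on_obj (conjugate C H T) M) = M"
    and "A \<in> Arr (functor_category C E) \<Longrightarrow>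
      on_arr (conjugate C H T) (on_arr (conjugate C H T) A) = A"
proof -
  let ?J = "conjugate C H T"
  interpret H: is_functor C "opposite C" H by (rule H)
  interpret J: is_functor "functor_category C E" "opposite (functor_category C E)" ?J
    by (rule conjugate_is_functor[OF H T])
  have HX: "on_obj H X \<in> Obj C" if "X \<in> Obj C" for X
    using H.on_obj_in_Obj[OF that] by simp
  have Hf: "on_arr H f \<in> Arr C" if "f \<in> Arr C" for f
    using Hom_Arr[OF H.on_arr_in_Hom[OF H.C.Arr_in_Hom[OF that]]] by simp
  show *: "on_obj ?J (on_obj ?J M) = M" if M: "M \<in> Obj (functor_category C E)" for M
  proof -
    interpret M: is_functor C E M using M by (simp add: functor_category_Obj)
    have Mf: "on_arr M f \<in> Arr E" if "f \<in> Arr C" for f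
      by (rule Hom_Arr[OF M.on_arr_in_Hom[OF H.C.Arr_in_Hom[OF that]]])
    have "on_obj ?J (on_obj ?J M) \<in> Obj (functor_category C E)"
      using J.on_obj_in_Obj M by simp
    then show ?thesis
      by (rule functor_category_Obj_eqI[OF _ M])
        (simp_all add: conjugate_on_obj HX Hf H_obj H_arr T_obj T_arr M.on_obj_in_Obj Mf)
  qed
  assume A: "A \<in> Arr (functor_category C E)"
  obtain M \<eta> N where M: "A = (M, \<eta>, N)" by (cases A)
  have "\<eta> X \<in> Arr E" if "X \<in> Obj C" for X
    using A M that natural_transformation.component_in_Hom[of C E M N \<eta> X]
    by (auto simp: functor_category_Arr Hom_def)
  then have "(\<lambda>X\<in>Obj C. on_arr T ((\<lambda>X\<in>Obj C. on_arr T (\<eta> (on_obj H X))) (on_obj H X))) = \<eta>"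
    using A M by (intro extensionalityI[where A = "Obj C"])
      (auto simp: functor_category_Arr HX H_obj T_arr)
  then show "on_arr ?J (on_arr ?J A) = A"
    using A M by (simp add: conjugate_on_arr functor_category_Arr *)
qed

lemma finitely_supported_opposite:
  "finitely_supported (opposite C) M \<longleftrightarrow> finitely_supported C M"
  by (simp add: finitely_supported_def isomorphic_opposite)

text \<open>If \<open>N S \<noteq> 0\<close>, then \<open>M (H S) \<noteq> 0\<close>, so \<open>H S\<close> is isomorphic to some representative \<open>T\<close>, and hence
  \<open>S = K (H S)\<close> is isomorphic to \<open>K T\<close>. Taking \<open>H\<close> to be a map of objects lets the same argument serve
  for covariant and for contravariant changes of the index category.\<close>

lemma finitely_supported_transfer:
  assumes M: "finitely_supported D M" and K: "is_functor D C K"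
    and HS: "\<And>S. S \<in> Obj C \<Longrightarrow> H S \<in> Obj D" and KH: "\<And>S. S \<in> Obj C \<Longrightarrow> on_obj K (H S) = S"
    and N: "\<And>S. S \<in> Obj C \<Longrightarrow> on_obj N S = on_obj M (H S)"
  shows "finitely_supported C N"
proof -
  interpret K: is_functor D C K by (rule K)
  obtain A where A: "finite A" "A \<subseteq> Obj D"
    and iso: "\<And>S. S \<in> Obj D \<Longrightarrow> carrier (on_obj M S) \<noteq> {\<zero>\<^bsub>on_obj M S\<^esub>} \<Longrightarrow>
      \<exists>T \<in> A. isomorphic D S T"
    using M unfolding finitely_supported_def by blast
  show ?thesis
    unfolding finitely_supported_def
  proof (intro exI[of _ "on_obj K ` A"] conjI ballI impI)
    fix S assume S: "S \<in> Obj C" and "carrier (on_obj N S) \<noteq> {\<zero>\<^bsub>on_obj N S\<^esub>}"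
    then obtain T where T: "T \<in> A" "isomorphic D (H S) T"
      using iso[OF HS[OF S]] N by auto
    then show "\<exists>T \<in> on_obj K ` A. isomorphic C S T"
      using is_functor_isomorphic[OF K T(2)] KH[OF S] by auto
  qed (use A K.on_obj_in_Obj in auto)
qed


section \<open>Weighted finite sets and weight reversal\<close>

lemma weighted_bijections_simps [simp]:
  "S \<in> Obj (weighted_bijections n R) \<longleftrightarrow> weighted_set n S"
  "Id (weighted_bijections n R) S = (S, \<lambda>x\<in>elements S. x, S)"
  "Comp (weighted_bijections n R) (T', \<psi>, U) (S, \<phi>, T) = (S, compose (elements S) \<psi> \<phi>, U)"
  by (simp_all add: weighted_bijections_def)

lemma weighted_bijections_Hom:
  "h \<in> Hom (weighted_bijections n R) S T \<longleftrightarrow>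
    (\<exists>\<phi>. h = (S, \<phi>, T) \<and> weighted_set n S \<and> weighted_set n T \<and>
      bij_betw \<phi> (elements S) (elements T) \<and> \<phi> \<in> extensional (elements S) \<and>
      (\<forall>x \<in> elements S. R (weight S x) (weight T (\<phi> x))))"
  by (cases h) (auto simp: Hom_def weighted_bijections_def)

lemma weighted_bijections_Arr:
  "(S, \<phi>, T) \<in> Arr (weighted_bijections n R) \<longleftrightarrow>
    (S, \<phi>, T) \<in> Hom (weighted_bijections n R) S T"
  by (simp add: Hom_def weighted_bijections_def)

lemma category_weighted_bijections:
  assumes refl: "\<And>i. R i i" and trans: "\<And>i j k. R i j \<Longrightarrow> R j k \<Longrightarrow> R i k"
  shows "category (weighted_bijections n R)"
proof
  let ?C = "weighted_bijections n R"
  fix h assume "h \<in> Arr ?C"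
  then show "Dom ?C h \<in> Obj ?C" "Cod ?C h \<in> Obj ?C"
    by (auto simp: weighted_bijections_def)
next
  fix S assume "S \<in> Obj (weighted_bijections n R)"
  then show "Id (weighted_bijections n R) S \<in> Hom (weighted_bijections n R) S S"
    by (auto simp: weighted_bijections_Hom refl bij_betw_def inj_on_def)
next
  fix f g S T U
  assume "f \<in> Hom (weighted_bijections n R) S T" "g \<in> Hom (weighted_bijections n R) T U"
  then obtain \<phi> \<psi> where f: "f = (S, \<phi>, T)" "bij_betw \<phi> (elements S) (elements T)"
      "\<And>x. x \<in> elements S \<Longrightarrow> R (weight S x) (weight T (\<phi> x))"
    and g: "g = (T, \<psi>, U)" "bij_betw \<psi> (elements T) (elements U)"
      "\<And>y. y \<in> elements T \<Longrightarrow> R (weight T y) (weight U (\<psi> y))"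
    and "weighted_set n S" "weighted_set n U"
    by (auto simp: weighted_bijections_Hom)
  moreover have "R (weight S x) (weight U (\<psi> (\<phi> x)))" if "x \<in> elements S" for x
    using f(3)[OF that] g(3)[OF bij_betw_apply[OF f(2) that]] by (rule trans)
  ultimately show "Comp (weighted_bijections n R) g f \<in> Hom (weighted_bijections n R) S U"
    using bij_betw_compose[OF f(2) g(2)] by (simp add: weighted_bijections_Hom compose_eq)
next
  fix f S T assume "f \<in> Hom (weighted_bijections n R) S T"
  then show "Comp (weighted_bijections n R) f (Id (weighted_bijections n R) S) = f"
    "Comp (weighted_bijections n R) (Id (weighted_bijections n R) T) f = f"
    by (auto simp: weighted_bijections_Hom
        intro!: compose_Id[OF bij_betw_imp_funcset] Id_compose[OF bij_betw_imp_funcset])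
next
  fix f g h S T U V
  assume "f \<in> Hom (weighted_bijections n R) S T" "g \<in> Hom (weighted_bijections n R) T U"
    "h \<in> Hom (weighted_bijections n R) U V"
  then show "Comp (weighted_bijections n R) h (Comp (weighted_bijections n R) g f) =
      Comp (weighted_bijections n R) (Comp (weighted_bijections n R) h g) f"
    by (auto simp: weighted_bijections_Hom intro!: compose_assoc bij_betw_imp_funcset)
qed

lemma category_U_cat: "category (U_cat n)"
  unfolding U_cat_def by (rule category_weighted_bijections) auto

lemma category_D_cat: "category (D_cat n)"
  unfolding D_cat_def by (rule category_weighted_bijections) auto

lemma weighted_set_rev:
  assumes "weighted_set n S"
  shows "weighted_set n (rev S)"
proof -
  have S: "length S = n" "\<And>i. i < n \<Longrightarrow> finite (S ! i)"
    "\<And>i j. i < n \<Longrightarrow> j < n \<Longrightarrow> i \<noteq> j \<Longrightarrow> S ! i \<inter> S ! j = {}"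
    using assms by (auto simp: weighted_set_def)
  have "rev S ! i \<inter> rev S ! j = {}" if "i < n" "j < n" "i \<noteq> j" for i j
    using that S(1) S(3)[of "n - Suc i" "n - Suc j"] by (simp add: rev_nth)
  then show ?thesis
    using S(1,2) by (simp add: weighted_set_def rev_nth)
qed

lemma elements_rev [simp]: "elements (rev S) = elements S"
  by (simp add: elements_def)

lemma weight_eq:
  assumes "weighted_set n S" "i < n" "x \<in> S ! i"
  shows "weight S x = Suc i"
  unfolding weight_def
proof (rule the_equality)
  fix j assume j: "1 \<le> j \<and> j \<le> length S \<and> x \<in> S ! (j - 1)"
  then have "j - 1 < n" "S ! i \<inter> S ! (j - 1) \<noteq> {}"
    using assms by (auto simp: weighted_set_def)
  then have "i = j - 1"
    using assms(1,2) unfolding weighted_set_def by blast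
  then show "j = Suc i" using j by simp
qed (use assms in \<open>simp add: weighted_set_def\<close>)

text \<open>The element at list position \<open>i\<close> has weight \<open>i + 1\<close>, and reversal moves it to position
  \<open>n - 1 - i\<close>.\<close>

lemma weight_rev:
  assumes S: "weighted_set n S" and x: "x \<in> elements S"
  shows "weight (rev S) x = n + 1 - weight S x"
proof -
  have n: "length S = n" using S by (simp add: weighted_set_def)
  obtain i where i: "i < n" "x \<in> S ! i"
    using x n by (auto simp: elements_def in_set_conv_nth)
  then have "x \<in> rev S ! (n - Suc i)"
    using n by (simp add: rev_nth)
  then have "weight (rev S) x = Suc (n - Suc i)"
    using weight_eq[OF weighted_set_rev[OF S], of "n - Suc i" x] i(1) by simp
  then show ?thesis
    using weight_eq[OF S i] i(1) by simp
qed

text \<open>Stated for arbitrary relations in order to serve for \<open>\<tau>\<close> in both directions.\<close>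

lemma tau_is_functor:
  assumes C: "category (weighted_bijections n R :: ('a wset, 'a wset_arr) cat)"
    and D: "category (weighted_bijections n R' :: ('a wset, 'a wset_arr) cat)"
    and RR': "\<And>i j. R i j \<Longrightarrow> R' (n + 1 - i) (n + 1 - j)"
  shows "is_functor (weighted_bijections n R :: ('a wset, 'a wset_arr) cat)
    (weighted_bijections n R') tau"
proof (rule is_functor.intro[OF C D], rule is_functor_axioms.intro)
  fix f and S T :: "'a wset" assume "f \<in> Hom (weighted_bijections n R) S T"
  then show "on_arr tau f \<in> Hom (weighted_bijections n R') (on_obj tau S) (on_obj tau T)"
    by (auto simp: weighted_bijections_Hom tau_def weighted_set_rev weight_rev bij_betw_apply
        intro!: RR'[simplified])
qed (auto simp: tau_def weighted_set_rev weighted_bijections_Hom)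

lemma tau_is_functor_U_D: "is_functor (U_cat n) (D_cat n) tau"
  using category_U_cat[of n] category_D_cat[of n] unfolding U_cat_def D_cat_def
  by (rule tau_is_functor) simp

lemma tau_is_functor_D_U: "is_functor (D_cat n) (U_cat n) tau"
  using category_D_cat[of n] category_U_cat[of n] unfolding U_cat_def D_cat_def
  by (rule tau_is_functor) simp

lemma tau_tau [simp]: "on_obj tau (on_obj tau S) = S" "on_arr tau (on_arr tau f) = f"
  by (simp_all add: tau_def split: prod.split)

text \<open>The contravariant involution of \<open>\<U>\<close>: taking inverses maps \<open>\<U>\<close> to the opposite of \<open>\<D>\<close>, and weight
  reversal returns to the opposite of \<open>\<U>\<close>.\<close>

definition reversed_inverse :: "('a wset, 'a wset_arr, 'a wset, 'a wset_arr) cat_functor" where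
  "reversed_inverse =
    \<lparr>on_obj = rev,
     on_arr = (\<lambda>(S, \<phi>, T). (rev T, \<lambda>y\<in>elements T. inv_into (elements S) \<phi> y, rev S))\<rparr>"

lemma bij_betw_inv_restrict:
  assumes "bij_betw \<phi> A B"
  shows "bij_betw (\<lambda>y\<in>B. inv_into A \<phi> y) B A"
  using bij_betw_inv_into[OF assms] by (simp cong: bij_betw_cong)

text \<open>If \<open>\<phi>\<close> does not decrease weights, then \<open>\<phi>\<^sup>-\<^sup>1\<close> does not increase them, and so does not decrease
  the reversed weights.\<close>

lemma reversed_inverse_is_functor: "is_functor (U_cat n) (opposite (U_cat n)) reversed_inverse"
proof -
  interpret U: category "U_cat n" by (rule category_U_cat)
  interpret Uo: category "opposite (U_cat n)" by (rule category_opposite[OF category_U_cat])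
  show ?thesis
  proof unfold_locales
    fix f S T assume "f \<in> Hom (U_cat n) S T"
    then obtain \<phi> where f: "f = (S, \<phi>, T)" and S: "weighted_set n S" and T: "weighted_set n T"
      and bij: "bij_betw \<phi> (elements S) (elements T)"
      and wt: "\<And>x. x \<in> elements S \<Longrightarrow> weight S x \<le> weight T (\<phi> x)"
      by (auto simp: U_cat_def weighted_bijections_Hom)
    have inv: "inv_into (elements S) \<phi> y \<in> elements S" "\<phi> (inv_into (elements S) \<phi> y) = y"
      if "y \<in> elements T" for y
      using bij that by (auto simp: bij_betw_def inv_into_into f_inv_into_f)
    have "weight (rev T) y \<le> weight (rev S) (inv_into (elements S) \<phi> y)" if y: "y \<in> elements T" for y
      using wt[OF inv(1)[OF y]] inv(2)[OF y]
      by (simp add: weight_rev[OF S inv(1)[OF y]] weight_rev[OF T y] diff_le_mono2)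
    then show "on_arr reversed_inverse f \<in>
        Hom (opposite (U_cat n)) (on_obj reversed_inverse S) (on_obj reversed_inverse T)"
      using bij_betw_inv_restrict[OF bij]
      by (simp add: reversed_inverse_def f U_cat_def weighted_bijections_Hom weighted_set_rev S T)
    fix g U assume "g \<in> Hom (U_cat n) T U"
    then obtain \<psi> where g: "g = (T, \<psi>, U)" and bij': "bij_betw \<psi> (elements T) (elements U)"
      by (auto simp: U_cat_def weighted_bijections_Hom)
    have "inv_into (elements S) (compose (elements S) \<psi> \<phi>) z =
        inv_into (elements S) \<phi> (inv_into (elements T) \<psi> z)" if "z \<in> elements U" for z
    proof (rule inv_into_f_eq)
      have z: "inv_into (elements T) \<psi> z \<in> elements T" "\<psi> (inv_into (elements T) \<psi> z) = z"
        using bij' that by (auto simp: bij_betw_def inv_into_into f_inv_into_f)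
      show "inj_on (compose (elements S) \<psi> \<phi>) (elements S)"
        using bij_betw_compose[OF bij bij'] by (simp add: bij_betw_def)
      show "inv_into (elements S) \<phi> (inv_into (elements T) \<psi> z) \<in> elements S"
        "compose (elements S) \<psi> \<phi> (inv_into (elements S) \<phi> (inv_into (elements T) \<psi> z)) = z"
        using inv[OF z(1)] z(2) by (simp_all add: compose_eq)
    qed
    moreover have "inv_into (elements T) \<psi> z \<in> elements T" if "z \<in> elements U" for z
      using bij' that by (auto simp: bij_betw_def inv_into_into)
    ultimately show "on_arr reversed_inverse (Comp (U_cat n) g f) =
        Comp (opposite (U_cat n)) (on_arr reversed_inverse g) (on_arr reversed_inverse f)"
      by (simp add: f g reversed_inverse_def U_cat_def compose_def cong: restrict_cong)
  next
    fix S assume "S \<in> Obj (U_cat n)"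
    have "inv_into (elements S) (\<lambda>x\<in>elements S. x) y = y" if "y \<in> elements S" for y
      using that by (intro inv_into_f_eq) (auto simp: inj_on_def)
    then show "on_arr reversed_inverse (Id (U_cat n) S) =
        Id (opposite (U_cat n)) (on_obj reversed_inverse S)"
      by (simp add: reversed_inverse_def U_cat_def cong: restrict_cong)
  qed (simp add: reversed_inverse_def U_cat_def weighted_set_rev)
qed

lemma reversed_inverse_involution:
  shows "on_obj reversed_inverse (on_obj reversed_inverse S) = S"
    and "f \<in> Arr (U_cat n) \<Longrightarrow> on_arr reversed_inverse (on_arr reversed_inverse f) = f"
proof -
  show "on_obj reversed_inverse (on_obj reversed_inverse S) = S"
    by (simp add: reversed_inverse_def)
  assume f: "f \<in> Arr (U_cat n)"
  obtain S \<phi> T where h: "f = (S, \<phi>, T)" by (cases f)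
  then have bij: "bij_betw \<phi> (elements S) (elements T)" and ext: "\<phi> \<in> extensional (elements S)"
    using f by (simp_all add: U_cat_def weighted_bijections_Arr weighted_bijections_Hom)
  have "inv_into (elements T) (\<lambda>y\<in>elements T. inv_into (elements S) \<phi> y) x = \<phi> x"
    if x: "x \<in> elements S" for x
    using bij_betw_apply[OF bij x] bij_betw_inv_into_left[OF bij x] bij_betw_inv_restrict[OF bij]
    by (intro inv_into_f_eq) (simp_all add: bij_betw_def)
  then have "(\<lambda>x\<in>elements S. inv_into (elements T) (\<lambda>y\<in>elements T. inv_into (elements S) \<phi> y) x) = \<phi>"
    using ext by (intro extensionalityI[where A = "elements S"]) simp_all
  then show "on_arr reversed_inverse (on_arr reversed_inverse f) = f"
    by (simp add: h reversed_inverse_def)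
qed


section \<open>Transposition of linear maps\<close>

definition linear_functional :: "'v vec_obj \<Rightarrow> ('v \<Rightarrow> complex) \<Rightarrow> bool" where
  "linear_functional V \<phi> \<longleftrightarrow>
    (\<forall>x \<in> carrier V. \<forall>y \<in> carrier V. \<phi> (x \<oplus>\<^bsub>V\<^esub> y) = \<phi> x + \<phi> y) \<and>
    (\<forall>c. \<forall>x \<in> carrier V. \<phi> (c \<odot>\<^bsub>V\<^esub> x) = c * \<phi> x)"

text \<open>The coordinates with respect to a finite basis \<open>B\<close>, in a form that hides linear combinations:
  the middle three properties say that \<open>V\<close> is isomorphic to the functions on \<open>B\<close>, and the last one
  that a linear functional is determined by its values on \<open>B\<close>.\<close>

lemma fin_dim_space_coordinates:
  assumes V: "fin_dim_space V"
  obtains B c where "finite B"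
    and "\<forall>b \<in> B. linear_functional V (\<lambda>x. c x b)"
    and "\<forall>x \<in> carrier V. \<forall>y \<in> carrier V. (\<forall>b \<in> B. c x b = c y b) \<longrightarrow> x = y"
    and "\<forall>a. \<exists>x \<in> carrier V. \<forall>b \<in> B. c x b = a b"
    and "\<forall>\<phi>. linear_functional V \<phi> \<longrightarrow> (\<forall>x \<in> carrier V. \<phi> x = (\<Sum>b\<in>B. c x b * \<phi> b))"
proof -
  interpret V: vectorspace "class_ring :: complex ring" V
    using V by (simp add: fin_dim_space_def)
  have "V.fin_dim" using V by (simp add: fin_dim_space_def)
  then obtain B where B: "finite B" "V.basis B" using V.finite_basis_exists by blast
  then have BV: "B \<subseteq> carrier V" by (simp add: V.basis_def)
  have ex1: "\<exists>!a. a \<in> B \<rightarrow>\<^sub>E UNIV \<and> V.lincomb a B = x" if "x \<in> carrier V" for x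
    using V.basis_criterion[OF B(1) BV] B(2) that by simp
  define c where "c x = (THE a. a \<in> B \<rightarrow>\<^sub>E UNIV \<and> V.lincomb a B = x)" for x
  have lin_c: "V.lincomb (c x) B = x" if "x \<in> carrier V" for x
    using theI'[OF ex1[OF that]] by (simp add: c_def)
  have in_V: "V.lincomb a B \<in> carrier V" for a
    using BV by (intro V.lincomb_closed) auto
  have c_lin: "c (V.lincomb a B) b = a b" if "b \<in> B" for a b
  proof -
    have "V.lincomb (restrict a B) B = V.lincomb a B"
      using BV by (intro V.lincomb_cong) auto
    then have "c (V.lincomb a B) = restrict a B"
      unfolding c_def by (intro the1_equality[OF ex1[OF in_V]]) auto
    then show ?thesis using that by simp
  qed
  have add: "c (x \<oplus>\<^bsub>V\<^esub> y) b = c x b + c y b"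
    if "x \<in> carrier V" "y \<in> carrier V" "b \<in> B" for x y b
  proof -
    have "V.lincomb (\<lambda>b. c x b + c y b) B = x \<oplus>\<^bsub>V\<^esub> y"
      using V.lincomb_sum[OF B(1) BV, of "c x" "c y"] lin_c that by simp
    then show ?thesis using c_lin[OF that(3), of "\<lambda>b. c x b + c y b"] by simp
  qed
  have smult: "c (k \<odot>\<^bsub>V\<^esub> x) b = k * c x b" if "x \<in> carrier V" "b \<in> B" for k x b
  proof -
    have "V.lincomb (\<lambda>b. k * c x b) B = k \<odot>\<^bsub>V\<^esub> x"
      using V.lincomb_smult[OF BV, of "c x" k] lin_c that by simp
    then show ?thesis using c_lin[OF that(2), of "\<lambda>b. k * c x b"] by simp
  qed
  have expand: "\<phi> (V.lincomb a A) = (\<Sum>b\<in>A. a b * \<phi> b)"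
    if \<phi>: "linear_functional V \<phi>" and A: "finite A" "A \<subseteq> carrier V" for \<phi> a A
    using A
  proof (induction A rule: finite_induct)
    case empty
    have "\<phi> (\<zero>\<^bsub>V\<^esub> \<oplus>\<^bsub>V\<^esub> \<zero>\<^bsub>V\<^esub>) = \<phi> \<zero>\<^bsub>V\<^esub> + \<phi> \<zero>\<^bsub>V\<^esub>"
      using \<phi> V.M.zero_closed unfolding linear_functional_def by blast
    then show ?case by (simp add: V.lincomb_def)
  next
    case (insert b A)
    then have b: "b \<in> carrier V" and A: "A \<subseteq> carrier V" by auto
    have "V.lincomb a (insert b A) = (a b \<odot>\<^bsub>V\<^esub> b) \<oplus>\<^bsub>V\<^esub> V.lincomb a A"
      using V.lincomb_insert2[of A a b] insert b A by simp
    moreover have "V.lincomb a A \<in> carrier V" "a b \<odot>\<^bsub>V\<^esub> b \<in> carrier V"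
      using A b by auto
    ultimately show ?case
      using \<phi> insert b by (simp add: linear_functional_def)
  qed
  show thesis
  proof (rule that[OF B(1)])
    show "\<forall>b \<in> B. linear_functional V (\<lambda>x. c x b)"
      using add smult by (simp add: linear_functional_def)
    show "\<forall>x \<in> carrier V. \<forall>y \<in> carrier V. (\<forall>b \<in> B. c x b = c y b) \<longrightarrow> x = y"
    proof (intro ballI impI)
      fix x y assume xy: "x \<in> carrier V" "y \<in> carrier V" and "\<forall>b \<in> B. c x b = c y b"
      then have "V.lincomb (c x) B = V.lincomb (c y) B"
        using BV by (intro V.lincomb_cong) auto
      then show "x = y" using lin_c xy by simp
    qed
    show "\<forall>a. \<exists>x \<in> carrier V. \<forall>b \<in> B. c x b = a b"
      using in_V c_lin by blast
    show "\<forall>\<phi>. linear_functional V \<phi> \<longrightarrow> (\<forall>x \<in> carrier V. \<phi> x = (\<Sum>b\<in>B. c x b * \<phi> b))"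
      using expand[OF _ B(1) BV] lin_c by metis
  qed
qed

text \<open>The last conjunct says that \<open>v \<mapsto> \<beta> _ v\<close> is a bijection from \<open>V\<close> to its dual; it subsumes
  nondegeneracy. Linearity in the second argument follows from symmetry.\<close>

definition perfect_symmetric_form :: "'v vec_obj \<Rightarrow> ('v \<Rightarrow> 'v \<Rightarrow> complex) \<Rightarrow> bool" where
  "perfect_symmetric_form V \<beta> \<longleftrightarrow>
    (\<forall>x \<in> carrier V. \<forall>y \<in> carrier V. \<beta> x y = \<beta> y x) \<and>
    (\<forall>y \<in> carrier V. linear_functional V (\<lambda>x. \<beta> x y)) \<and>
    (\<forall>\<phi>. linear_functional V \<phi> \<longrightarrow> (\<exists>!v. v \<in> carrier V \<and> (\<forall>x \<in> carrier V. \<phi> x = \<beta> x v)))"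

text \<open>The standard bilinear form \<open>\<Sum>b. x\<^sub>b y\<^sub>b\<close> in the coordinates of a basis: the functional \<open>\<phi>\<close> is
  represented by the vector whose coordinates are the values of \<open>\<phi>\<close> on the basis. It is bilinear
  rather than a Hermitian inner product, since transposition has to be complex linear.\<close>

lemma perfect_symmetric_form_exists:
  assumes V: "fin_dim_space V"
  shows "\<exists>\<beta>. perfect_symmetric_form V \<beta>"
proof -
  obtain B c where B: "finite B"
    and lin: "\<forall>b \<in> B. linear_functional V (\<lambda>x. c x b)"
    and inj: "\<forall>x \<in> carrier V. \<forall>y \<in> carrier V. (\<forall>b \<in> B. c x b = c y b) \<longrightarrow> x = y"
    and surj: "\<forall>a. \<exists>x \<in> carrier V. \<forall>b \<in> B. c x b = a b"
    and expand: "\<forall>\<phi>. linear_functional V \<phi> \<longrightarrow>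
      (\<forall>x \<in> carrier V. \<phi> x = (\<Sum>b\<in>B. c x b * \<phi> b))"
    by (rule fin_dim_space_coordinates[OF V])
  define \<beta> where "\<beta> x y = (\<Sum>b\<in>B. c x b * c y b)" for x y
  have "linear_functional V (\<lambda>x. \<beta> x y)" for y
    using lin by (simp add: linear_functional_def \<beta>_def distrib_right sum.distrib
        sum_distrib_left mult.assoc)
  moreover have "\<exists>!v. v \<in> carrier V \<and> (\<forall>x \<in> carrier V. \<phi> x = \<beta> x v)"
    if \<phi>: "linear_functional V \<phi>" for \<phi>
  proof -
    obtain v where v: "v \<in> carrier V" "\<And>b. b \<in> B \<Longrightarrow> c v b = \<phi> b" using surj by blast
    have rep: "\<phi> x = \<beta> x v" if "x \<in> carrier V" for x
      using expand \<phi> that v(2) by (simp add: \<beta>_def)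
    have "w = v" if w: "w \<in> carrier V" "\<And>x. x \<in> carrier V \<Longrightarrow> \<phi> x = \<beta> x w" for w
    proof -
      have "c w b = c v b" if b: "b \<in> B" for b
      proof -
        \<comment> \<open>Pairing with the vector \<open>x\<close> that has the coordinates of \<open>b\<close> reads off the coordinate at \<open>b\<close>.\<close>
        obtain x where x: "x \<in> carrier V" "\<forall>b' \<in> B. c x b' = (if b' = b then 1 else 0)"
          using surj[rule_format, of "\<lambda>b'. if b' = b then 1 else 0"] by blast
        have "\<beta> x u = c u b" for u
          using b B x(2) by (simp add: \<beta>_def if_distrib[of "\<lambda>t. t * _"] cong: if_cong)
        then show ?thesis using rep[OF x(1)] w(2)[OF x(1)] by simp
      qed
      then show ?thesis using inj w(1) v(1) by blast
    qed
    then show ?thesis using v(1) rep by blast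
  qed
  ultimately have "perfect_symmetric_form V \<beta>"
    by (simp add: perfect_symmetric_form_def \<beta>_def mult.commute)
  then show ?thesis by blast
qed

definition form :: "'v vec_obj \<Rightarrow> 'v \<Rightarrow> 'v \<Rightarrow> complex" where
  "form V = (SOME \<beta>. perfect_symmetric_form V \<beta>)"

lemma form_perfect: "fin_dim_space V \<Longrightarrow> perfect_symmetric_form V (form V)"
  unfolding form_def by (rule someI_ex[OF perfect_symmetric_form_exists])

lemma form_commute:
  "fin_dim_space V \<Longrightarrow> x \<in> carrier V \<Longrightarrow> y \<in> carrier V \<Longrightarrow> form V x y = form V y x"
  using form_perfect[of V] by (simp add: perfect_symmetric_form_def)

lemma form_linear:
  "fin_dim_space V \<Longrightarrow> y \<in> carrier V \<Longrightarrow> linear_functional V (\<lambda>x. form V x y)"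
  using form_perfect[of V] by (simp add: perfect_symmetric_form_def)

lemma form_represents:
  "fin_dim_space V \<Longrightarrow> linear_functional V \<phi> \<Longrightarrow>
    \<exists>!v. v \<in> carrier V \<and> (\<forall>x \<in> carrier V. \<phi> x = form V x v)"
  using form_perfect[of V] by (simp add: perfect_symmetric_form_def)

lemma form_nondegenerate:
  assumes V: "fin_dim_space V" and "v \<in> carrier V" "w \<in> carrier V"
    and "\<And>x. x \<in> carrier V \<Longrightarrow> form V x v = form V x w"
  shows "v = w"
  using form_represents[OF V form_linear[OF V assms(2)]] assms(2-4) by blast

definition lin_hom :: "'v vec_obj \<Rightarrow> 'v vec_obj \<Rightarrow> ('v \<Rightarrow> 'v) set" where
  "lin_hom V W =
    {f \<in> LinearCombinations.module_hom (class_ring :: complex ring) V W. f \<in> extensional (carrier V)}"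

lemma lin_homI:
  assumes "\<And>x. x \<in> carrier V \<Longrightarrow> f x \<in> carrier W"
    and "\<And>x y. x \<in> carrier V \<Longrightarrow> y \<in> carrier V \<Longrightarrow> f (x \<oplus>\<^bsub>V\<^esub> y) = f x \<oplus>\<^bsub>W\<^esub> f y"
    and "\<And>c x. x \<in> carrier V \<Longrightarrow> f (c \<odot>\<^bsub>V\<^esub> x) = c \<odot>\<^bsub>W\<^esub> f x"
    and "f \<in> extensional (carrier V)"
  shows "f \<in> lin_hom V W"
  using assms by (auto simp: lin_hom_def LinearCombinations.module_hom_def)

lemma lin_homD:
  assumes "f \<in> lin_hom V W"
  shows "f \<in> carrier V \<rightarrow> carrier W" "f \<in> extensional (carrier V)"
    and "x \<in> carrier V \<Longrightarrow> f x \<in> carrier W"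
    and "x \<in> carrier V \<Longrightarrow> y \<in> carrier V \<Longrightarrow> f (x \<oplus>\<^bsub>V\<^esub> y) = f x \<oplus>\<^bsub>W\<^esub> f y"
    and "x \<in> carrier V \<Longrightarrow> f (c \<odot>\<^bsub>V\<^esub> x) = c \<odot>\<^bsub>W\<^esub> f x"
  using assms by (auto simp: lin_hom_def LinearCombinations.module_hom_def)

lemma fin_dim_space_closed:
  assumes "fin_dim_space V" "x \<in> carrier V"
  shows "y \<in> carrier V \<Longrightarrow> x \<oplus>\<^bsub>V\<^esub> y \<in> carrier V" "c \<odot>\<^bsub>V\<^esub> x \<in> carrier V"
proof -
  interpret vectorspace "class_ring :: complex ring" V
    using assms by (simp add: fin_dim_space_def)
  show "y \<in> carrier V \<Longrightarrow> x \<oplus>\<^bsub>V\<^esub> y \<in> carrier V" "c \<odot>\<^bsub>V\<^esub> x \<in> carrier V"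
    using assms(2) by simp_all
qed

lemma Vec_simps [simp]:
  "V \<in> Obj Vec \<longleftrightarrow> fin_dim_space V"
  "Id Vec V = (V, \<lambda>x\<in>carrier V. x, V)"
  "Comp Vec (W', g, X) (V, f, W) = (V, compose (carrier V) g f, X)"
  by (simp_all add: Vec_def)

lemma Vec_Hom:
  "h \<in> Hom Vec V W \<longleftrightarrow> (\<exists>f. h = (V, f, W) \<and> fin_dim_space V \<and> fin_dim_space W \<and> f \<in> lin_hom V W)"
proof -
  have "linear_map class_ring V W f \<longleftrightarrow> f \<in> LinearCombinations.module_hom class_ring V W"
    if "fin_dim_space V" "fin_dim_space W" for f
    using that by (simp add: linear_map_def mod_hom_def mod_hom_axioms_def fin_dim_space_def
        vectorspace_def)
  then show ?thesis
    by (cases h) (auto simp: Hom_def Vec_def lin_hom_def)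
qed

lemma Vec_Arr: "(V, f, W) \<in> Arr Vec \<longleftrightarrow> (V, f, W) \<in> Hom Vec V W"
  by (simp add: Hom_def Vec_def)

lemma lin_hom_Id: "fin_dim_space V \<Longrightarrow> (\<lambda>x\<in>carrier V. x) \<in> lin_hom V V"
  by (rule lin_homI) (simp_all add: fin_dim_space_closed)

lemma lin_hom_compose:
  assumes "fin_dim_space V" "f \<in> lin_hom V W" "g \<in> lin_hom W X"
  shows "compose (carrier V) g f \<in> lin_hom V X"
  by (rule lin_homI)
    (simp_all add: compose_eq fin_dim_space_closed assms(1) lin_homD[OF assms(2)] lin_homD[OF assms(3)])

lemma category_Vec: "category Vec"
proof
  fix h :: "'a vec_arr" assume "h \<in> Arr Vec"
  then show "Dom Vec h \<in> Obj Vec" "Cod Vec h \<in> Obj Vec"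
    by (auto simp: Vec_def)
next
  fix f g and V W X :: "'a vec_obj" assume "f \<in> Hom Vec V W" "g \<in> Hom Vec W X"
  then show "Comp Vec g f \<in> Hom Vec V X"
    by (auto simp: Vec_Hom intro: lin_hom_compose)
next
  fix f and V W :: "'a vec_obj" assume "f \<in> Hom Vec V W"
  then show "Comp Vec f (Id Vec V) = f" "Comp Vec (Id Vec W) f = f"
    by (auto simp: Vec_Hom lin_homD(2)
        intro!: compose_Id[OF lin_homD(1)] Id_compose[OF lin_homD(1)])
next
  fix f g h and V W X Y :: "'a vec_obj"
  assume "f \<in> Hom Vec V W" "g \<in> Hom Vec W X" "h \<in> Hom Vec X Y"
  then show "Comp Vec h (Comp Vec g f) = Comp Vec (Comp Vec h g) f"
    by (auto simp: Vec_Hom intro!: compose_assoc lin_homD(1))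
qed (auto simp: Vec_Hom lin_hom_Id)

definition adjoint :: "'v vec_obj \<Rightarrow> 'v vec_obj \<Rightarrow> ('v \<Rightarrow> 'v) \<Rightarrow> ('v \<Rightarrow> 'v) \<Rightarrow> bool" where
  "adjoint V W f g \<longleftrightarrow>
    (\<forall>x \<in> carrier V. \<forall>y \<in> carrier W. form W (f x) y = form V x (g y))"

text \<open>The preimage of the functional \<open>x \<mapsto> \<langle>f x, y\<rangle>\<close> under the identification of \<open>V\<close> with its
  dual.\<close>

definition transpose_map :: "'v vec_obj \<Rightarrow> 'v vec_obj \<Rightarrow> ('v \<Rightarrow> 'v) \<Rightarrow> 'v \<Rightarrow> 'v" where
  "transpose_map V W f =
    (\<lambda>y\<in>carrier W. THE v. v \<in> carrier V \<and> (\<forall>x \<in> carrier V. form W (f x) y = form V x v))"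

text \<open>Linearity of the transpose comes from nondegeneracy: both sides of each equation have the same
  pairing with every \<open>x\<close>.\<close>

lemma transpose_map_adjoint:
  assumes V: "fin_dim_space V" and W: "fin_dim_space W" and f: "f \<in> lin_hom V W"
  shows "transpose_map V W f \<in> lin_hom W V" "adjoint V W f (transpose_map V W f)"
proof -
  let ?g = "transpose_map V W f"
  have *: "?g y \<in> carrier V \<and> (\<forall>x \<in> carrier V. form W (f x) y = form V x (?g y))"
    if y: "y \<in> carrier W" for y
  proof -
    have "linear_functional V (\<lambda>x. form W (f x) y)"
      using form_linear[OF W y] by (simp add: linear_functional_def lin_homD[OF f])
    from theI'[OF form_represents[OF V this]] show ?thesis
      unfolding transpose_map_def restrict_apply'[OF y] .
  qed
  then have g: "?g y \<in> carrier V" if "y \<in> carrier W" for y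
    using that by blast
  from * show "adjoint V W f ?g"
    by (simp add: adjoint_def)
  have add: "form U x (y \<oplus>\<^bsub>U\<^esub> z) = form U x y + form U x z"
    if "fin_dim_space U" "x \<in> carrier U" "y \<in> carrier U" "z \<in> carrier U" for U :: "'a vec_obj" and x y z
    using form_linear[OF that(1,2)] that
    by (simp add: form_commute[OF that(1,2)] fin_dim_space_closed linear_functional_def)
  have smult: "form U x (c \<odot>\<^bsub>U\<^esub> y) = c * form U x y"
    if "fin_dim_space U" "x \<in> carrier U" "y \<in> carrier U" for U :: "'a vec_obj" and c x y
    using form_linear[OF that(1,2)] that
    by (simp add: form_commute[OF that(1,2)] fin_dim_space_closed linear_functional_def)
  show "?g \<in> lin_hom W V"
  proof (rule lin_homI)
    fix y z assume yz: "y \<in> carrier W" "z \<in> carrier W"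
    show "?g (y \<oplus>\<^bsub>W\<^esub> z) = ?g y \<oplus>\<^bsub>V\<^esub> ?g z"
    proof (rule form_nondegenerate[OF V])
      fix x assume x: "x \<in> carrier V"
      show "form V x (?g (y \<oplus>\<^bsub>W\<^esub> z)) = form V x (?g y \<oplus>\<^bsub>V\<^esub> ?g z)"
        using *[OF yz(1)] *[OF yz(2)] *[OF fin_dim_space_closed(1)[OF W yz]] x
          add[OF W lin_homD(3)[OF f x] yz] add[OF V x, of "?g y" "?g z"] by metis
    qed (use g yz V W in \<open>simp_all add: fin_dim_space_closed\<close>)
  next
    fix c y assume y: "y \<in> carrier W"
    show "?g (c \<odot>\<^bsub>W\<^esub> y) = c \<odot>\<^bsub>V\<^esub> ?g y"
    proof (rule form_nondegenerate[OF V])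
      fix x assume x: "x \<in> carrier V"
      show "form V x (?g (c \<odot>\<^bsub>W\<^esub> y)) = form V x (c \<odot>\<^bsub>V\<^esub> ?g y)"
        using *[OF y] *[OF fin_dim_space_closed(2)[OF W y]] x
          smult[OF W lin_homD(3)[OF f x] y] smult[OF V x, of "?g y"] by metis
    qed (use g y V W in \<open>simp_all add: fin_dim_space_closed\<close>)
  qed (rule g, assumption, simp add: transpose_map_def)
qed

text \<open>Adjoints are unique. Hence transposes of identities, composites and transposes are computed by
  exhibiting an adjoint.\<close>

lemma transpose_map_eqI:
  assumes V: "fin_dim_space V" and W: "fin_dim_space W" and f: "f \<in> lin_hom V W"
    and g: "g \<in> lin_hom W V" and adj: "adjoint V W f g"
  shows "transpose_map V W f = g"
proof (rule extensionalityI[where A = "carrier W"])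
  note t = transpose_map_adjoint[OF V W f]
  fix y assume y: "y \<in> carrier W"
  show "transpose_map V W f y = g y"
    by (rule form_nondegenerate[OF V lin_homD(3)[OF t(1) y] lin_homD(3)[OF g y]])
      (use t(2) adj y in \<open>simp add: adjoint_def\<close>)
qed (use lin_homD[OF g] in \<open>simp_all add: transpose_map_def\<close>)

text \<open>This is where symmetry of the forms enters; it makes transposition an involution.\<close>

lemma adjoint_sym:
  assumes "fin_dim_space V" "fin_dim_space W" "f \<in> lin_hom V W" "g \<in> lin_hom W V"
    and "adjoint V W f g"
  shows "adjoint W V g f"
  using assms(5) unfolding adjoint_def
  by (metis form_commute[OF assms(1)] form_commute[OF assms(2)] lin_homD(3)[OF assms(3)]
      lin_homD(3)[OF assms(4)])

text \<open>Linear duality after identifying each space with its dual by the chosen form, so that it fixes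
  objects.\<close>

definition transposition :: "('v vec_obj, 'v vec_arr, 'v vec_obj, 'v vec_arr) cat_functor" where
  "transposition =
    \<lparr>on_obj = (\<lambda>V. V), on_arr = (\<lambda>(V, f, W). (W, transpose_map V W f, V))\<rparr>"

lemma transposition_is_functor: "is_functor Vec (opposite Vec) transposition"
proof -
  interpret Vec: category Vec by (rule category_Vec)
  interpret Vec': category "opposite Vec" by (rule category_opposite[OF category_Vec])
  show ?thesis
  proof unfold_locales
    fix h and V W :: "'a vec_obj" assume "h \<in> Hom Vec V W"
    then obtain f where h: "h = (V, f, W)" and V: "fin_dim_space V" and W: "fin_dim_space W"
      and f: "f \<in> lin_hom V W" by (auto simp: Vec_Hom)
    note ft = transpose_map_adjoint[OF V W f]
    show "on_arr transposition h \<in>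
        Hom (opposite Vec) (on_obj transposition V) (on_obj transposition W)"
      using ft(1) by (simp add: h transposition_def Vec_Hom V W)
    fix k X assume "k \<in> Hom Vec W X"
    then obtain g where k: "k = (W, g, X)" and X: "fin_dim_space X" and g: "g \<in> lin_hom W X"
      by (auto simp: Vec_Hom)
    note gt = transpose_map_adjoint[OF W X g]
    have "transpose_map V X (compose (carrier V) g f) =
        compose (carrier X) (transpose_map V W f) (transpose_map W X g)"
      using ft(2) gt(2)
      by (intro transpose_map_eqI[OF V X] lin_hom_compose[OF V f g] lin_hom_compose[OF X gt(1) ft(1)])
        (simp add: adjoint_def compose_eq lin_homD(3)[OF f] lin_homD(3)[OF gt(1)])
    then show "on_arr transposition (Comp Vec k h) =
        Comp (opposite Vec) (on_arr transposition k) (on_arr transposition h)"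
      by (simp add: h k transposition_def)
  next
    fix V :: "'a vec_obj" assume "V \<in> Obj Vec"
    then have "transpose_map V V (\<lambda>x\<in>carrier V. x) = (\<lambda>x\<in>carrier V. x)"
      by (intro transpose_map_eqI) (simp_all add: lin_hom_Id adjoint_def)
    then show "on_arr transposition (Id Vec V) = Id (opposite Vec) (on_obj transposition V)"
      by (simp add: transposition_def)
  qed (simp add: transposition_def)
qed

lemma transposition_involution:
  shows "on_obj transposition (on_obj transposition V) = V"
    and "h \<in> Arr Vec \<Longrightarrow> on_arr transposition (on_arr transposition h) = h"
proof -
  show "on_obj transposition (on_obj transposition V) = V"
    by (simp add: transposition_def)
  assume h: "h \<in> Arr Vec"
  obtain V f W where *: "h = (V, f, W)" by (cases h)
  then have V: "fin_dim_space V" and W: "fin_dim_space W" and f: "f \<in> lin_hom V W"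
    using h by (auto simp: Vec_Arr Vec_Hom)
  note t = transpose_map_adjoint[OF V W f]
  have "transpose_map W V (transpose_map V W f) = f"
    by (rule transpose_map_eqI[OF W V t(1) f adjoint_sym[OF V W f t]])
  then show "on_arr transposition (on_arr transposition h) = h"
    by (simp add: * transposition_def)
qed


section \<open>Modules\<close>

text \<open>Besides \<open>pullback_is_functor\<close>, only preservation of finite support is at stake; there the inverse
  of the functor pulled back along carries representatives over.\<close>

lemma tau_shriek_is_functor:
  "is_functor (Mod_U n :: ('a, 'v) mod_cat) (Mod_D n) (tau_shriek n)"
  unfolding Mod_U_def Mod_D_def tau_shriek_def
proof (rule is_functor_full_subcategory[OF pullback_is_functor[OF tau_is_functor_D_U category_Vec]])
  interpret is_functor "D_cat n" "U_cat n" tau by (rule tau_is_functor_D_U)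
  fix M :: "('a, 'v) wset_functor" assume "finitely_supported (U_cat n) M"
  then show "finitely_supported (D_cat n) (on_obj (pullback (D_cat n) tau) M)"
    by (rule finitely_supported_transfer[OF _ tau_is_functor_U_D, where H = "on_obj tau"])
      (simp_all add: on_obj_in_Obj pullback_on_obj)
qed

lemma tau_star_is_functor:
  "is_functor (Mod_D n :: ('a, 'v) mod_cat) (Mod_U n) (tau_star n)"
  unfolding Mod_U_def Mod_D_def tau_star_def
proof (rule is_functor_full_subcategory[OF pullback_is_functor[OF tau_is_functor_U_D category_Vec]])
  interpret is_functor "U_cat n" "D_cat n" tau by (rule tau_is_functor_U_D)
  fix M :: "('a, 'v) wset_functor" assume "finitely_supported (D_cat n) M"
  then show "finitely_supported (U_cat n) (on_obj (pullback (U_cat n) tau) M)"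
    by (rule finitely_supported_transfer[OF _ tau_is_functor_D_U, where H = "on_obj tau"])
      (simp_all add: on_obj_in_Obj pullback_on_obj)
qed

lemma tau_equivalence:
  "equivalence_of_categories
    (Mod_U n :: ('a, 'v) mod_cat) (Mod_D n :: ('a, 'v) mod_cat) (tau_shriek n) (tau_star n)"
  by (rule equivalence_if_strict_inverse[OF tau_shriek_is_functor tau_star_is_functor])
    (simp_all add: Mod_U_def Mod_D_def tau_shriek_def tau_star_def
      pullback_inverse[OF tau_is_functor_D_U tau_is_functor_U_D category_Vec]
      pullback_inverse[OF tau_is_functor_U_D tau_is_functor_D_U category_Vec])

text \<open>The duality \<open>M \<mapsto> (S \<mapsto> (M (rev S))\<^sup>*)\<close>. Transposition does not change spaces, so the support of the
  dual module is the support of \<open>M\<close> with all weights reversed; and as isomorphism of objects is the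
  same relation in \<open>\<U>\<close> and in its opposite, finiteness can be transferred along a contravariant
  functor.\<close>

lemma Mod_U_self_dual: "self_dual (Mod_U n :: ('a, 'v) mod_cat)"
proof -
  let ?J = "conjugate (U_cat n) reversed_inverse transposition :: ('a, 'v) mod_functor"
  interpret H: is_functor "U_cat n" "opposite (U_cat n)" reversed_inverse
    by (rule reversed_inverse_is_functor)
  have "is_functor (Mod_U n) (full_subcategory (opposite (functor_category (U_cat n) Vec))
      (finitely_supported (U_cat n))) ?J"
    unfolding Mod_U_def
  proof (rule is_functor_full_subcategory[OF conjugate_is_functor
        [OF reversed_inverse_is_functor transposition_is_functor]])
    fix M :: "('a, 'v) wset_functor" assume "finitely_supported (U_cat n) M"
    then have "finitely_supported (opposite (U_cat n)) M"
      by (simp add: finitely_supported_opposite)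
    then show "finitely_supported (U_cat n) (on_obj ?J M)"
    proof (rule finitely_supported_transfer[where H = "on_obj reversed_inverse"])
      show "is_functor (opposite (U_cat n)) (U_cat n) reversed_inverse"
        using is_functor_opposite[OF reversed_inverse_is_functor] by simp
    qed (use H.on_obj_in_Obj in \<open>simp_all add: reversed_inverse_involution conjugate_on_obj
        transposition_def\<close>)
  qed
  then have "is_functor (Mod_U n) (opposite (Mod_U n)) ?J"
    by (simp add: full_subcategory_opposite Mod_U_def)
  then show ?thesis
    by (rule self_dual_if_involution)
      (simp_all add: Mod_U_def conjugate_involution[OF reversed_inverse_is_functor
        transposition_is_functor] reversed_inverse_involution transposition_involution)
qed

theorem proposition2p2:
  fixes n :: nat
  assumes "n \<ge> 1"
  shows "equivalence_of_categories
           (Mod_U n :: ('a, 'v) mod_cat) (Mod_D n :: ('a, 'v) mod_cat) (tau_shriek n) (tau_star n)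
       \<and> self_dual (Mod_U n :: ('a, 'v) mod_cat)"
  using tau_equivalence Mod_U_self_dual by blast

end
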